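(* Let $\Omega\subset\mathbb{R}^n$ be a domain and let $u:\Omega\to\mathbb{R}$ be a continuous function. Then $u$ is subharmonic in $\Omega$ if and only if $$\frac{1}{|B(a,r)|}\int_{B(a,r)}u(x)\,dx\;\le\;\frac{1}{|\partial B(a,r)|}\int_{\partial B(a,r)}u(x)\,ds$$ for all balls $B(a,r)$ whose closure is contained in $\Omega$.
   Context: $B(a,r)$ denotes the open ball in $\mathbb{R}^n$ with centre $a$ and radius $r>0$; $|B(a,r)|$ is its volume, $|\partial B(a,r)|$ the surface measure of its boundary, and $ds$ surface measure. A real-valued function $u$ defined in $\Omega$ is called subharmonic if $u$ is continuous and for every ball $B$ whose closure is contained in $\Omega$ and every function $h$ harmonic in $B$ (continuous up to $\partial B$) satisfying $h\ge u$ on $\partial B$, one has $h\ge u$ in $B$. *)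

theory Defs
  imports "HOL-Analysis.Analysis"
begin

text \<open>
  Surface measure on the sphere with centre \<open>a\<close> and radius \<open>r\<close> in dimension \<open>n\<close>, by the usual cone
  construction of polar coordinates: on the unit sphere the surface measure of \<open>A\<close> is \<open>n\<close> times the
  Lebesgue measure of the solid cone \<open>{t y | y \<in> A, 0 < t < 1}\<close>, and it scales with \<open>r ^ (n - 1)\<close>.
  In dimension 1 this is the counting measure on the two boundary points.
  The result is a Borel measure on the whole space which is concentrated on the sphere.
\<close>

definition surface_measure :: "'a::euclidean_space \<Rightarrow> real \<Rightarrow> 'a measure" where
  "surface_measure a r =
     scale_measure (ennreal (real DIM('a) * r ^ (DIM('a) - 1)))
       (distr (restrict_space lborel (ball 0 1 - {0})) borel (\<lambda>x. a + r *\<^sub>R (x /\<^sub>R norm x)))"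

lemma sets_surface_measure [simp, measurable_cong]: "sets (surface_measure a r) = sets borel"
  by (simp add: surface_measure_def)

lemma space_surface_measure [simp]: "space (surface_measure a r) = UNIV"
  by (simp add: surface_measure_def space_scale_measure)

lemma emeasure_surface_measure:
  fixes a :: "'a::euclidean_space"
  assumes "A \<in> sets borel"
  shows "emeasure (surface_measure a r) A =
    ennreal (real DIM('a) * r ^ (DIM('a) - 1)) *
      emeasure lborel {x. 0 < norm x \<and> norm x < 1 \<and> a + r *\<^sub>R (x /\<^sub>R norm x) \<in> A}"
proof -
  let ?f = "\<lambda>x::'a. a + r *\<^sub>R (x /\<^sub>R norm x)"
  let ?S = "ball (0::'a) 1 - {0}"
  have S: "?S \<in> sets lborel" by simp
  have m: "?f \<in> measurable (restrict_space lborel ?S) borel"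
    by (rule measurable_restrict_space1) simp
  let ?C = "{x. 0 < norm x \<and> norm x < 1 \<and> ?f x \<in> A}"
  have "?f -` A \<inter> space (restrict_space lborel ?S) = ?C"
    by (auto simp: space_restrict_space)
  moreover have "emeasure (restrict_space lborel ?S) ?C = emeasure lborel ?C"
    by (rule emeasure_restrict_space) auto
  ultimately have "emeasure (distr (restrict_space lborel ?S) borel ?f) A = emeasure lborel ?C"
    by (simp only: emeasure_distr[OF m assms])
  then show ?thesis
    by (simp add: surface_measure_def)
qed

lemma measure_surface_measure_sphere:
  fixes a :: "'a::euclidean_space"
  assumes "r > 0"
  shows "measure (surface_measure a r) (sphere a r)
    = real DIM('a) * unit_ball_vol (real DIM('a)) * r ^ (DIM('a) - 1)"
proof -
  have eq: "{x::'a. 0 < norm x \<and> norm x < 1 \<and> a + r *\<^sub>R (x /\<^sub>R norm x) \<in> sphere a r}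
      = ball 0 1 - {0}"
    using assms by (auto simp: dist_norm)
  have "emeasure lborel (ball (0::'a) 1 - {0}) = emeasure lborel (ball (0::'a) 1)"
    by (rule emeasure_Diff_null_set) (auto simp: null_sets_def)
  also have "\<dots> = ennreal (unit_ball_vol (real DIM('a)))"
    by (simp add: emeasure_ball)
  finally have "emeasure (surface_measure a r) (sphere a r)
      = ennreal (real DIM('a) * r ^ (DIM('a) - 1)) * ennreal (unit_ball_vol (real DIM('a)))"
    by (subst emeasure_surface_measure) (simp, simp only: eq)
  then show ?thesis
    using assms by (simp add: measure_def enn2real_mult)
qed

lemma emeasure_surface_measure_compl_sphere:
  fixes a :: "'a::euclidean_space"
  assumes "r > 0"
  shows "emeasure (surface_measure a r) (- sphere a r) = 0"
proof -
  have "a + r *\<^sub>R (x /\<^sub>R norm x) \<in> sphere a r" if "0 < norm x" for x :: 'a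
    using assms that by (simp add: dist_norm)
  then have "{x::'a. 0 < norm x \<and> norm x < 1 \<and> a + r *\<^sub>R (x /\<^sub>R norm x) \<in> - sphere a r} = {}"
    by blast
  moreover have "- sphere a r \<in> sets borel"
    by (simp add: borel_closed borel_comp)
  ultimately show ?thesis
    by (simp only: emeasure_surface_measure emeasure_empty mult_zero_right)
qed

text \<open>
  A function is harmonic on an open set if it is twice continuously differentiable there, with
  gradient \<open>g\<close> and Hessian \<open>H\<close>, and its Laplacian, the trace of the Hessian, vanishes.
\<close>

definition harmonic_on :: "('a::euclidean_space \<Rightarrow> real) \<Rightarrow> 'a set \<Rightarrow> bool" where
  "harmonic_on h S \<longleftrightarrow>
     (\<exists>(g :: 'a \<Rightarrow> 'a) (H :: 'a \<Rightarrow> 'a \<Rightarrow> 'a).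
        (\<forall>x\<in>S. GDERIV h x :> g x) \<and>
        (\<forall>x\<in>S. (g has_derivative H x) (at x)) \<and>
        (\<forall>v. continuous_on S (\<lambda>x. H x v)) \<and>
        (\<forall>x\<in>S. (\<Sum>b\<in>Basis. H x b \<bullet> b) = 0))"

definition subharmonic_on :: "('a::euclidean_space \<Rightarrow> real) \<Rightarrow> 'a set \<Rightarrow> bool" where
  "subharmonic_on u \<Omega> \<longleftrightarrow>
     continuous_on \<Omega> u \<and>
     (\<forall>a r h. r > 0 \<longrightarrow> cball a r \<subseteq> \<Omega> \<longrightarrow>
        harmonic_on h (ball a r) \<longrightarrow> continuous_on (cball a r) h \<longrightarrow>
        (\<forall>x\<in>sphere a r. h x \<ge> u x) \<longrightarrow> (\<forall>x\<in>ball a r. h x \<ge> u x))"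

end

theory Submission
  imports Defs
begin

text \<open>
  Write \<open>F r\<close> for the integral of a continuous function over the ball of radius \<open>r\<close> about a fixed
  centre, and \<open>G r\<close> for its mean over the bounding sphere times the volume of the unit ball. In
  dimension \<open>n\<close> the inequality between the two means reads \<open>F r \<le> r\<^sup>n G r\<close>. The main tool is the formula
  \<open>F' r = n r\<^sup>n\<^sup>-\<^sup>1 G r\<close> (\<open>has_real_derivative_ball_integral\<close>), from which
  \<open>(F r / r\<^sup>n)' = n (r\<^sup>n G r - F r) / r\<^sup>n\<^sup>+\<^sup>1\<close>: the ball mean increases with the radius exactly where it is
  at most the sphere mean.

  For harmonic \<open>h\<close> the ball mean is constant, because its derivative in \<open>r\<close> is a multiple of the integral
  of \<open>\<nabla>h \<bullet> (x - a)\<close>, which vanishes by the divergence theorem. Hence ball means and sphere means of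
  harmonic functions coincide (\<open>harmonic_ball_eq_sphere\<close>). The divergence theorem enters only for
  fields that vanish on the sphere, where it follows from the translation invariance of the integral
  (\<open>set_integral_directional_derivative_eq_0\<close>).

  If \<open>u\<close> is subharmonic, one would like to compare it with the harmonic function \<open>h\<close> that has the same
  boundary values: \<open>u \<le> h\<close> in the ball, and the ball mean of \<open>h\<close> is the sphere mean of \<open>u\<close>. An
  approximate \<open>h\<close> is enough, so it suffices that harmonic functions are uniformly dense in the continuous
  functions on a sphere (\<open>harmonic_approximable_sphere\<close>). By Stone-Weierstrass exponentials of linear
  forms span a dense subspace, and each power of a linear form agrees on the sphere with an explicit
  harmonic polynomial (\<open>ridge_power_harmonic_on_sphere\<close>).

  Conversely, let \<open>u\<close> satisfy the inequality and let \<open>h\<close> be harmonic with \<open>h \<ge> u\<close> on the boundary of a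
  ball. As the means of \<open>h\<close> agree, \<open>w = u - h\<close> satisfies the inequality as well. Its ball means are
  therefore increasing in the radius and, since they tend to the value at the centre, bounded below by
  it (\<open>value_le_ball_mean\<close>). This is the sub-mean-value property, and the maximum principle
  (\<open>maximum_principle_ball_mean\<close>) gives \<open>w \<le> 0\<close>.
\<close>

section \<open>Surface integrals as integrals over the unit ball\<close>

lemma set_integrable_continuous_cball:
  fixes f :: "'a::euclidean_space \<Rightarrow> real"
  assumes "continuous_on (cball a r) f" "A \<subseteq> cball a r" "A \<in> sets borel"
  shows "set_integrable lborel A f"
proof -
  have "set_integrable lborel (cball a r) f"
    unfolding set_integrable_def by (rule borel_integrable_compact) (use assms in auto)
  then show ?thesis
    by (rule set_integrable_subset) (use assms in auto)
qed

lemma set_integral_ball_scale: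
  fixes f :: "'a::euclidean_space \<Rightarrow> real"
  assumes "r > 0" "set_borel_measurable lborel (ball a r) f"
  shows "(LINT x:ball a r|lborel. f x)
    = r ^ DIM('a) * (LINT x:ball 0 1|lborel. f (a + r *\<^sub>R x))"
proof -
  define g where "g = (\<lambda>x. indicator (ball a r) x *\<^sub>R f x)"
  have m: "g \<in> borel_measurable borel"
    using assms(2) by (simp add: g_def set_borel_measurable_def)
  have aff: "(\<lambda>x. a + r *\<^sub>R x) \<in> measurable lborel borel" by simp
  have ind: "indicator (ball a r) (a + r *\<^sub>R x) = (indicator (ball 0 1) x :: real)" for x
    using assms(1) by (auto simp: indicator_def dist_norm)
  have "integral\<^sup>L lborel g
    = integral\<^sup>L (density (distr lborel borel (\<lambda>x. a + r *\<^sub>R x)) (\<lambda>_. ennreal (\<bar>r\<bar> ^ DIM('a)))) g"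
    using lborel_affine[of r a] assms(1) by simp
  also have "\<dots> = \<bar>r\<bar> ^ DIM('a) * integral\<^sup>L (distr lborel borel (\<lambda>x. a + r *\<^sub>R x)) g"
    by (subst integral_density) (use m in auto)
  also have "integral\<^sup>L (distr lborel borel (\<lambda>x. a + r *\<^sub>R x)) g = integral\<^sup>L lborel (\<lambda>x. g (a + r *\<^sub>R x))"
    by (rule integral_distr[OF aff m])
  finally show ?thesis
    using assms(1) by (simp add: set_lebesgue_integral_def g_def ind)
qed

lemma measure_ball_lborel:
  fixes a :: "'a::euclidean_space"
  assumes "r \<ge> 0"
  shows "measure lborel (ball a r) = unit_ball_vol (real DIM('a)) * r ^ DIM('a)"
  using content_ball[OF assms, of a] by (simp add: measure_def)

text \<open>
  The values of \<open>f\<close> on the sphere, extended constantly along rays from the centre and integrated over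
  the unit ball. Up to the factor \<open>n r\<^sup>n\<^sup>-\<^sup>1\<close> this is the surface integral of \<open>f\<close>, and up to the
  volume of the unit ball it is the mean of \<open>f\<close> over the sphere. Since \<open>sgn 0 = 0\<close>, the centre is the
  only point at which \<open>f\<close> is evaluated off the sphere.
\<close>

definition radial_integral :: "('a::euclidean_space \<Rightarrow> real) \<Rightarrow> 'a \<Rightarrow> real \<Rightarrow> real" where
  "radial_integral f a r = (LINT x:ball 0 1|lborel. f (a + r *\<^sub>R sgn x))"

lemma radial_point_in_cball:
  fixes a x :: "'a::euclidean_space"
  assumes "r \<ge> 0"
  shows "a + r *\<^sub>R sgn x \<in> cball a r"
  using assms by (simp add: dist_norm norm_sgn)

lemma borel_measurable_radial:
  fixes f :: "'a::euclidean_space \<Rightarrow> real"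
  assumes "r \<ge> 0" "continuous_on (cball a r) f"
  shows "(\<lambda>x. f (a + r *\<^sub>R sgn x)) \<in> borel_measurable borel"
proof -
  have m: "(\<lambda>x. indicator (cball a r) x *\<^sub>R f x) \<in> borel_measurable borel"
    by (rule borel_measurable_continuous_on_indicator) (use assms in auto)
  have p: "(\<lambda>x::'a. a + r *\<^sub>R sgn x) \<in> borel_measurable borel"
    unfolding sgn_div_norm by measurable
  have "(\<lambda>x. f (a + r *\<^sub>R sgn x))
      = (\<lambda>x. indicator (cball a r) (a + r *\<^sub>R sgn x) *\<^sub>R f (a + r *\<^sub>R sgn x))"
    using radial_point_in_cball[OF assms(1), of a] by (simp add: indicator_def del: mem_cball)
  with measurable_compose[OF p m] show ?thesis by simp
qed

lemma set_integrable_radial: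
  fixes f :: "'a::euclidean_space \<Rightarrow> real"
  assumes "r \<ge> 0" "continuous_on (cball a r) f"
  shows "set_integrable lborel (ball p s) (\<lambda>x. f (a + r *\<^sub>R sgn (x - q)))"
proof -
  have m: "(\<lambda>x. f (a + r *\<^sub>R sgn (x - q))) \<in> borel_measurable borel"
    by (rule measurable_compose[OF _ borel_measurable_radial[OF assms]]) measurable
  have "compact (f ` cball a r)" by (rule compact_continuous_image[OF assms(2)]) simp
  then obtain B where B: "\<And>y. y \<in> cball a r \<Longrightarrow> norm (f y) \<le> B"
    by (meson bounded_iff compact_imp_bounded imageI)
  have "norm (f (a + r *\<^sub>R sgn (x - q))) \<le> B" for x
    by (intro B radial_point_in_cball assms)
  then show ?thesis unfolding set_integrable_def
    by (intro integrableI_bounded_set[where A = "ball p s" and B = B])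
      (use m emeasure_lborel_ball_finite[of p s] in \<open>auto simp: indicator_def\<close>)
qed

lemma radial_integral_diff:
  fixes f g :: "'a::euclidean_space \<Rightarrow> real"
  assumes "r \<ge> 0" "continuous_on (cball a r) f" "continuous_on (cball a r) g"
  shows "radial_integral (\<lambda>x. f x - g x) a r = radial_integral f a r - radial_integral g a r"
  using set_integral_diff(2)[OF set_integrable_radial[OF assms(1,2), of 0 1 0]
      set_integrable_radial[OF assms(1,3), of 0 1 0]]
  by (simp add: radial_integral_def)

lemma radial_integral_le:
  fixes f g :: "'a::euclidean_space \<Rightarrow> real"
  assumes r: "r \<ge> 0" and f: "continuous_on (cball a r) f" and g: "continuous_on (cball a r) g"
    and le: "\<And>x. x \<in> sphere a r \<Longrightarrow> f x \<le> g x + c"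
  shows "radial_integral f a r \<le> radial_integral g a r + c * unit_ball_vol (real DIM('a))"
proof -
  let ?h = "\<lambda>x. g x + c"
  have h: "continuous_on (cball a r) ?h" by (intro continuous_intros g)
  have "radial_integral f a r \<le> radial_integral ?h a r"
    unfolding radial_integral_def set_lebesgue_integral_def
  proof (rule integral_mono_AE)
    show "integrable lborel (\<lambda>x. indicator (ball 0 1) x *\<^sub>R f (a + r *\<^sub>R sgn x))"
      "integrable lborel (\<lambda>x. indicator (ball 0 1) x *\<^sub>R ?h (a + r *\<^sub>R sgn x))"
      using set_integrable_radial[OF r f, of 0 1 0] set_integrable_radial[OF r h, of 0 1 0]
      by (simp_all add: set_integrable_def)
    have "AE x in lborel. x \<noteq> (0::'a)" by (rule AE_lborel_singleton)
    then show "AE x in lborel. indicator (ball 0 1) x *\<^sub>R f (a + r *\<^sub>R sgn x)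
        \<le> indicator (ball 0 1) x *\<^sub>R ?h (a + r *\<^sub>R sgn x)"
    proof eventually_elim
      case (elim x)
      then have "a + r *\<^sub>R sgn x \<in> sphere a r" using r by (simp add: dist_norm norm_sgn)
      then show ?case using le by (simp add: indicator_def)
    qed
  qed
  also have "radial_integral ?h a r - radial_integral g a r = radial_integral (\<lambda>_. c) a r"
    using radial_integral_diff[OF r h g] by simp
  then have "radial_integral ?h a r = radial_integral g a r + c * unit_ball_vol (real DIM('a))"
    using emeasure_lborel_ball_finite[of "0::'a" 1] measure_ball_lborel[of 1 "0::'a"]
    by (simp add: radial_integral_def set_integral_const algebra_simps)
  finally show ?thesis .
qed

lemma set_integral_surface_measure:
  fixes f :: "'a::euclidean_space \<Rightarrow> real"
  assumes "r > 0" "continuous_on (cball a r) f"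
  shows "(LINT x:sphere a r|surface_measure a r. f x)
    = real DIM('a) * r ^ (DIM('a) - 1) * radial_integral f a r"
proof -
  define c where "c = real DIM('a) * r ^ (DIM('a) - 1)"
  have c0: "c \<ge> 0" using assms by (simp add: c_def)
  let ?p = "\<lambda>x::'a. a + r *\<^sub>R (x /\<^sub>R norm x)"
  let ?S = "ball (0::'a) 1 - {0}"
  let ?M = "restrict_space lborel ?S"
  define g where "g = (\<lambda>x. indicator (sphere a r) x *\<^sub>R f x)"
  have m: "g \<in> borel_measurable borel"
    unfolding g_def by (rule borel_measurable_continuous_on_indicator)
      (use assms in \<open>auto intro: continuous_on_subset\<close>)
  have p: "?p \<in> measurable ?M borel"
    by (rule measurable_restrict_space1) simp
  have gp: "g (?p x) = f (a + r *\<^sub>R sgn x)" if "x \<noteq> 0" for x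
    using that assms by (simp add: g_def dist_norm sgn_div_norm)
  have "surface_measure a r = density (distr ?M borel ?p) (\<lambda>_. ennreal c)"
    unfolding surface_measure_def c_def
    by (rule measure_eqI) (auto simp: emeasure_density nn_integral_cmult_indicator)
  then have "integral\<^sup>L (surface_measure a r) g = c * integral\<^sup>L (distr ?M borel ?p) g"
    by (simp only:) (subst integral_density, use m c0 in auto)
  also have "integral\<^sup>L (distr ?M borel ?p) g = integral\<^sup>L ?M (\<lambda>x. g (?p x))"
    by (rule integral_distr[OF p m])
  also have "\<dots> = (LINT x:?S|lborel. g (?p x))"
    by (subst integral_restrict_space) (auto simp: set_lebesgue_integral_def)
  also have "\<dots> = (LINT x:?S|lborel. f (a + r *\<^sub>R sgn x))"
    by (rule set_lebesgue_integral_cong) (use gp in \<open>auto simp del: scaleR_scaleR\<close>)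
  also have "\<dots> = radial_integral f a r"
    unfolding radial_integral_def set_lebesgue_integral_def
  proof (rule integral_cong_AE)
    have mr: "(\<lambda>x. f (a + r *\<^sub>R sgn x)) \<in> borel_measurable borel"
      by (rule borel_measurable_radial) (use assms in auto)
    then show "(\<lambda>x. indicator ?S x *\<^sub>R f (a + r *\<^sub>R sgn x)) \<in> borel_measurable lborel"
      "(\<lambda>x. indicator (ball 0 1) x *\<^sub>R f (a + r *\<^sub>R sgn x)) \<in> borel_measurable lborel"
      by (auto intro!: borel_measurable_times borel_measurable_indicator)
    have "AE x in lborel. x \<noteq> (0::'a)" by (rule AE_lborel_singleton)
    then show "AE x in lborel. indicator ?S x *\<^sub>R f (a + r *\<^sub>R sgn x)
        = indicator (ball 0 1) x *\<^sub>R f (a + r *\<^sub>R sgn x)"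
      by eventually_elim (auto simp: indicator_def)
  qed
  finally show ?thesis by (simp add: set_lebesgue_integral_def g_def c_def)
qed

text \<open>
  The volume of the unit ball and the factor \<open>n r\<^sup>n\<^sup>-\<^sup>1\<close> cancel; the rest of the argument uses the
  normalised form on the right-hand side, in which surface measure no longer occurs.
\<close>

lemma ball_mean_le_sphere_mean_iff:
  fixes f :: "'a::euclidean_space \<Rightarrow> real"
  assumes "r > 0" "continuous_on (cball a r) f"
  shows "1 / measure lborel (ball a r) * (LINT x:ball a r|lborel. f x)
         \<le> 1 / measure (surface_measure a r) (sphere a r)
             * (LINT x:sphere a r|surface_measure a r. f x)
    \<longleftrightarrow> (LINT x:ball a r|lborel. f x) \<le> r ^ DIM('a) * radial_integral f a r"
proof -
  let ?n = "DIM('a)" and ?F = "LINT x:ball a r|lborel. f x" and ?G = "radial_integral f a r"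
  define V where "V = unit_ball_vol (real ?n)"
  have V: "V > 0" by (simp add: V_def)
  have vol: "measure lborel (ball a r) = V * r ^ ?n"
    using assms by (simp add: V_def measure_ball_lborel)
  have "1 / (V * r ^ ?n) * ?F \<le> 1 / (real ?n * V * r ^ (?n - 1)) * (real ?n * r ^ (?n - 1) * ?G)
    \<longleftrightarrow> ?F / (V * r ^ ?n) \<le> ?G / V"
    using assms V by simp
  also have "\<dots> \<longleftrightarrow> ?F \<le> r ^ ?n * ?G"
    using assms V by (simp add: field_simps)
  finally show ?thesis
    using assms by (simp only: vol set_integral_surface_measure measure_surface_measure_sphere
        flip: V_def)
qed

section \<open>The derivative of a ball integral with respect to the radius\<close>

text \<open>
  The integrand depends only on the direction of \<open>x - a\<close>, so a dilation of the ball changes the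
  integral by the Jacobian factor alone.
\<close>

lemma set_integral_ball_homogeneous:
  fixes f :: "'a::euclidean_space \<Rightarrow> real"
  assumes "r \<ge> 0" "continuous_on (cball a r) f" "s > 0"
  shows "(LINT x:ball a s|lborel. f (a + r *\<^sub>R sgn (x - a))) = s ^ DIM('a) * radial_integral f a r"
proof -
  have "(\<lambda>x. f (a + r *\<^sub>R sgn (x - a))) \<in> borel_measurable borel"
    by (rule measurable_compose[OF _ borel_measurable_radial[OF assms(1,2)]]) measurable
  then have "set_borel_measurable lborel (ball a s) (\<lambda>x. f (a + r *\<^sub>R sgn (x - a)))"
    unfolding set_borel_measurable_def
    by (intro borel_measurable_scaleR borel_measurable_indicator) auto
  from set_integral_ball_scale[OF assms(3) this] assms(3) show ?thesis
    by (simp add: radial_integral_def sgn_scaleR)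
qed

lemma set_integral_shell_bound:
  fixes k :: "'a::euclidean_space \<Rightarrow> real"
  assumes "0 \<le> p" "p \<le> q" "set_integrable lborel (ball a q) k"
    and bd: "\<And>x. p \<le> dist a x \<Longrightarrow> dist a x < q \<Longrightarrow> \<bar>k x\<bar> \<le> e"
  shows "\<bar>(LINT x:ball a q|lborel. k x) - (LINT x:ball a p|lborel. k x)\<bar>
    \<le> e * unit_ball_vol (real DIM('a)) * (q ^ DIM('a) - p ^ DIM('a))"
proof -
  let ?D = "ball a q - ball a p"
  have D: "?D \<in> sets lborel" by simp
  have int: "set_integrable lborel A k" if "A \<subseteq> ball a q" "A \<in> sets lborel" for A
    by (rule set_integrable_subset[OF assms(3)]) (use that in auto)
  have fin: "emeasure lborel ?D < \<infinity>"
    by (rule order.strict_trans1[OF emeasure_mono emeasure_lborel_ball_finite]) auto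
  have sub: "ball a p \<subseteq> ball a q" using assms by (intro subset_ball) auto
  have "(LINT x:ball a q|lborel. k x)
      = (LINT x:ball a p|lborel. k x) + (LINT x:?D|lborel. k x)"
    by (subst set_integral_Un[symmetric])
      (use sub int D in \<open>auto simp: Un_absorb1\<close>)
  moreover have "\<bar>LINT x:?D|lborel. k x\<bar> \<le> e * measure lborel ?D"
  proof -
    have "\<bar>LINT x:?D|lborel. k x\<bar> \<le> (LINT x:?D|lborel. \<bar>k x\<bar>)"
      using set_integral_norm_bound[OF int[OF _ D]] by simp
    also have "\<dots> \<le> (LINT x:?D|lborel. e)"
      by (rule set_integral_mono)
        (use set_integrable_abs[OF int[OF _ D]] bd fin in \<open>auto simp: set_integrable_def\<close>)
    also have "\<dots> = e * measure lborel ?D"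
      using fin by (simp add: set_integral_const)
    finally show ?thesis .
  qed
  moreover have "measure lborel ?D = measure lborel (ball a q) - measure lborel (ball a p)"
    by (rule measure_Diff) (use sub emeasure_lborel_ball_finite[of a q] in auto)
  ultimately show ?thesis
    using assms by (simp add: measure_ball_lborel algebra_simps)
qed

text \<open>
  In the thin shell between the spheres of radius \<open>r\<close> and \<open>s\<close>, uniform continuity makes \<open>f\<close> differ
  by at most a small \<open>e'\<close> from the function \<open>g\<close> that is constant along rays and agrees with \<open>f\<close> on the
  sphere of radius \<open>r\<close>. The integral of \<open>g\<close> over the shell is exactly \<open>(s\<^sup>n - r\<^sup>n)\<close> times the radial
  integral, and the volume of the shell is also proportional to \<open>s\<^sup>n - r\<^sup>n\<close>. So it is natural to take
  difference quotients with respect to \<open>s\<^sup>n\<close> instead of \<open>s\<close> and to apply the chain rule at the end.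
\<close>

lemma has_real_derivative_ball_integral:
  fixes f :: "'a::euclidean_space \<Rightarrow> real"
  assumes r: "0 < r" "r < R" and f: "continuous_on (cball a R) f"
  shows "((\<lambda>s. LINT x:ball a s|lborel. f x)
    has_real_derivative real DIM('a) * r ^ (DIM('a) - 1) * radial_integral f a r) (at r)"
proof -
  let ?n = "DIM('a)"
  let ?F = "\<lambda>s. LINT x:ball a s|lborel. f x"
  let ?G = "radial_integral f a r"
  let ?V = "unit_ball_vol (real ?n)"
  define g where "g = (\<lambda>x. f (a + r *\<^sub>R sgn (x - a)))"
  have fr: "continuous_on (cball a r) f"
    using f by (rule continuous_on_subset) (use r in auto)
  have g_int: "set_integrable lborel (ball a s) g" for s
    unfolding g_def using r by (intro set_integrable_radial[OF _ fr]) simp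
  have diff: "?F s - s ^ ?n * ?G = (LINT x:ball a s|lborel. f x - g x)" if "0 < s" "s < R" for s
  proof -
    have "set_integrable lborel (ball a s) f"
      by (rule set_integrable_continuous_cball[OF f]) (use that in auto)
    from set_integral_diff(2)[OF this g_int[of s]] that r show ?thesis
      using set_integral_ball_homogeneous[OF _ fr, of s] by (simp add: g_def)
  qed
  have quot: "((\<lambda>s. (?F s - ?F r) / (s ^ ?n - r ^ ?n)) \<longlongrightarrow> ?G) (at r)"
  proof (rule tendstoI)
    fix e :: real assume e: "e > 0"
    define e' where "e' = e / (2 * ?V)"
    have V: "?V > 0" by simp
    have e': "e' > 0" "e' * ?V < e" using e V by (auto simp: e'_def)
    have "uniformly_continuous_on (cball a R) f"
      using f compact_cball by (rule compact_uniformly_continuous)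
    then obtain d where d: "d > 0"
      "\<And>x y. x \<in> cball a R \<Longrightarrow> y \<in> cball a R \<Longrightarrow> dist x y < d \<Longrightarrow> dist (f x) (f y) < e'"
      using e' unfolding uniformly_continuous_on_def by (metis dist_commute)
    have bd: "\<bar>f x - g x\<bar> \<le> e'"
      if "\<bar>dist a x - r\<bar> < d" "dist a x < R" "x \<noteq> a" for x
    proof -
      have "x - (a + r *\<^sub>R sgn (x - a)) = (norm (x - a) - r) *\<^sub>R sgn (x - a)"
        using that by (simp add: sgn_div_norm algebra_simps)
      then have "dist x (a + r *\<^sub>R sgn (x - a)) = \<bar>norm (x - a) - r\<bar>"
        using that by (simp add: dist_norm norm_sgn)
      also have "\<dots> < d" using that by (simp add: dist_norm norm_minus_commute)
      finally show ?thesis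
        using d(2)[of x "a + r *\<^sub>R sgn (x - a)"] that r radial_point_in_cball[of r a "x - a"]
        by (simp add: g_def dist_real_def)
    qed
    have est: "\<bar>(LINT x:ball a q|lborel. f x - g x) - (LINT x:ball a p|lborel. f x - g x)\<bar>
        \<le> e' * ?V * (q ^ ?n - p ^ ?n)"
      if "0 < p" "p \<le> q" "q < R" "\<bar>p - r\<bar> < d" "\<bar>q - r\<bar> < d" for p q
    proof (rule set_integral_shell_bound)
      show "set_integrable lborel (ball a q) (\<lambda>x. f x - g x)"
        by (rule set_integral_diff(1)[OF set_integrable_continuous_cball[OF f] g_int]) (use that in auto)
    qed (use that in \<open>auto intro!: bd\<close>)
    have "dist ((?F s - ?F r) / (s ^ ?n - r ^ ?n)) ?G < e"
      if s: "0 < s" "s < R" "\<bar>s - r\<bar> < d" "s \<noteq> r" for s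
    proof -
      have ne: "s ^ ?n \<noteq> r ^ ?n" using s r by (simp add: power_eq_iff_eq_base)
      have "\<bar>(?F s - s ^ ?n * ?G) - (?F r - r ^ ?n * ?G)\<bar> \<le> e' * ?V * \<bar>s ^ ?n - r ^ ?n\<bar>"
      proof (cases "r \<le> s")
        case True
        then have "r ^ ?n \<le> s ^ ?n" using r by (intro power_mono) auto
        then show ?thesis using est[of r s] diff[of r] diff[of s] s r d True by simp
      next
        case False
        then have "s ^ ?n \<le> r ^ ?n" using s by (intro power_mono) auto
        then show ?thesis using est[of s r] diff[of r] diff[of s] s r d False by simp
      qed
      moreover have "(?F s - ?F r) / (s ^ ?n - r ^ ?n) - ?G
          = ((?F s - s ^ ?n * ?G) - (?F r - r ^ ?n * ?G)) / (s ^ ?n - r ^ ?n)"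
        using ne by (simp add: field_simps)
      ultimately have "\<bar>(?F s - ?F r) / (s ^ ?n - r ^ ?n) - ?G\<bar> \<le> e' * ?V"
        using ne by (simp add: abs_divide divide_le_eq)
      then show ?thesis using e' by (simp add: dist_real_def)
    qed
    moreover have "\<forall>\<^sub>F s in at r. s \<noteq> r \<and> \<bar>s - r\<bar> < min d (min r (R - r))"
      unfolding eventually_at using d r
      by (intro exI[of _ "min d (min r (R - r))"]) (auto simp: dist_real_def)
    ultimately show "\<forall>\<^sub>F s in at r. dist ((?F s - ?F r) / (s ^ ?n - r ^ ?n)) ?G < e"
      by (elim eventually_mono) (auto simp: abs_less_iff)
  qed
  have "((\<lambda>s. s ^ ?n) has_real_derivative real ?n * r ^ (?n - 1)) (at r)"
    by (auto intro!: derivative_eq_intros)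
  then have "((\<lambda>s. (s ^ ?n - r ^ ?n) / (s - r)) \<longlongrightarrow> real ?n * r ^ (?n - 1)) (at r)"
    by (simp add: has_field_derivative_iff)
  from tendsto_mult[OF this quot]
  have lim: "((\<lambda>s. (s ^ ?n - r ^ ?n) / (s - r) * ((?F s - ?F r) / (s ^ ?n - r ^ ?n)))
    \<longlongrightarrow> real ?n * r ^ (?n - 1) * ?G) (at r)" .
  have "\<forall>\<^sub>F s in at r. (s ^ ?n - r ^ ?n) / (s - r) * ((?F s - ?F r) / (s ^ ?n - r ^ ?n))
      = (?F s - ?F r) / (s - r)"
    unfolding eventually_at using r
    by (intro exI[of _ r]) (auto simp: dist_real_def power_eq_iff_eq_base)
  from Lim_transform_eventually[OF lim this] show ?thesis
    by (simp add: has_field_derivative_iff)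
qed

section \<open>Integrals of derivatives of functions vanishing on a sphere\<close>

lemma has_real_derivative_integral:
  fixes f :: "real \<Rightarrow> 'b \<Rightarrow> real"
  assumes d: "d > 0"
    and int: "\<And>t. \<bar>t - t0\<bar> < d \<Longrightarrow> integrable M (f t)"
    and w: "integrable M w"
    and lip: "\<And>t x. x \<in> space M \<Longrightarrow> \<bar>t - t0\<bar> < d \<Longrightarrow> \<bar>f t x - f t0 x\<bar> \<le> w x * \<bar>t - t0\<bar>"
    and der: "AE x in M. ((\<lambda>t. f t x) has_real_derivative f' x) (at t0)"
    and f': "f' \<in> borel_measurable M"
  shows "((\<lambda>t. \<integral>x. f t x \<partial>M) has_real_derivative (\<integral>x. f' x \<partial>M)) (at t0)"
  unfolding has_field_derivative_iff tendsto_at_iff_sequentially comp_def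
proof (intro allI impI)
  fix X :: "nat \<Rightarrow> real"
  assume X: "\<forall>i. X i \<in> UNIV - {t0}" "X \<longlonglongrightarrow> t0"
  then obtain N where N: "\<And>n. n \<ge> N \<Longrightarrow> \<bar>X n - t0\<bar> < d"
    using LIMSEQ_D[OF X(2) d] by auto
  define Y where "Y = (\<lambda>n. X (n + N))"
  have Y: "Y n \<noteq> t0" "\<bar>Y n - t0\<bar> < d" for n using X N by (auto simp: Y_def)
  have Ylim: "Y \<longlonglongrightarrow> t0" unfolding Y_def using X(2) by (rule LIMSEQ_ignore_initial_segment)
  let ?q = "\<lambda>n x. (f (Y n) x - f t0 x) / (Y n - t0)"
  have "(\<lambda>n. \<integral>x. ?q n x \<partial>M) \<longlonglongrightarrow> (\<integral>x. f' x \<partial>M)"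
  proof (rule integral_dominated_convergence[where w = w])
    show "f' \<in> borel_measurable M" "integrable M w" by fact+
    show "?q n \<in> borel_measurable M" for n
      using int[OF Y(2)[of n]] int[of t0] d by (intro borel_measurable_divide) auto
    show "AE x in M. norm (?q n x) \<le> w x" for n
      using lip[OF _ Y(2)] Y(1) by (intro AE_I2) (simp add: divide_le_eq)
    show "AE x in M. (\<lambda>n. ?q n x) \<longlonglongrightarrow> f' x"
      using der
    proof eventually_elim
      case (elim x)
      then have "\<forall>Z. (\<forall>i. Z i \<in> UNIV - {t0}) \<longrightarrow> Z \<longlonglongrightarrow> t0 \<longrightarrow>
          (\<lambda>n. (f (Z n) x - f t0 x) / (Z n - t0)) \<longlonglongrightarrow> f' x"
        unfolding has_field_derivative_iff tendsto_at_iff_sequentially comp_def .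
      then show ?case using Y(1) Ylim by blast
    qed
  qed
  moreover have "(\<integral>x. ?q n x \<partial>M) = ((\<integral>x. f (Y n) x \<partial>M) - (\<integral>x. f t0 x \<partial>M)) / (Y n - t0)" for n
    using int[OF Y(2)[of n]] int[of t0] d by simp
  ultimately have "(\<lambda>n. ((\<integral>x. f (X (n + N)) x \<partial>M) - (\<integral>x. f t0 x \<partial>M)) / (X (n + N) - t0))
      \<longlonglongrightarrow> (\<integral>x. f' x \<partial>M)"
    by (simp only: Y_def)
  then show "(\<lambda>n. ((\<integral>x. f (X n) x \<partial>M) - (\<integral>x. f t0 x \<partial>M)) / (X n - t0)) \<longlonglongrightarrow> (\<integral>x. f' x \<partial>M)"
    by (rule LIMSEQ_offset)
qed

text \<open>
  The integral of a translate \<open>x \<mapsto> X (x + t v)\<close> does not depend on \<open>t\<close>. Differentiating at \<open>t = 0\<close>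
  under the integral sign, with the Lipschitz constant as majorant, gives the claim.
\<close>

lemma integral_directional_derivative_eq_0:
  fixes X :: "'a::euclidean_space \<Rightarrow> real"
  assumes lip: "\<And>x y. \<bar>X x - X y\<bar> \<le> L * dist x y"
    and supp: "\<And>x. x \<notin> cball a r \<Longrightarrow> X x = 0"
    and der: "AE x in lborel. ((\<lambda>t. X (x + t *\<^sub>R v)) has_real_derivative X' x) (at 0)"
    and X': "X' \<in> borel_measurable borel"
  shows "(\<integral>x. X' x \<partial>lborel) = 0"
proof -
  have "L \<ge> 0"
  proof -
    obtain b :: 'a where "b \<in> Basis" using nonempty_Basis by blast
    then have "dist b 0 = 1" by (simp add: dist_norm)
    then show ?thesis using lip[of b 0] by simp
  qed
  then have "L-lipschitz_on UNIV X"
    using lip by (intro lipschitz_onI) (auto simp: dist_real_def)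
  then have cont: "continuous_on UNIV X" by (rule lipschitz_on_continuous_on)
  have "X = (\<lambda>x. indicator (cball a r) x *\<^sub>R X x)"
    using supp by (auto simp: indicator_def fun_eq_iff simp del: mem_cball)
  with borel_integrable_compact[of "cball a r" X] cont have intX: "integrable lborel X"
    by (metis compact_cball continuous_on_subset top_greatest)
  have plus: "(+) c \<in> measurable lborel borel" for c :: 'a by simp
  have intt: "integrable lborel (\<lambda>x. X (x + c))" for c
    using integrable_distr_eq[OF plus, of X c] intX cont
    by (simp add: lborel_distr_plus add.commute borel_measurable_continuous_onI)
  have eq: "(\<integral>x. X (x + c) \<partial>lborel) = (\<integral>x. X x \<partial>lborel)" for c
    using integral_distr[OF plus, of X c] cont
    by (simp add: lborel_distr_plus add.commute borel_measurable_continuous_onI)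
  \<comment> \<open>For \<open>|t| < 1\<close> the translates vanish outside this larger ball.\<close>
  let ?w = "\<lambda>x. indicator (cball a (r + norm v)) x * (L * norm v)"
  have "((\<lambda>t. \<integral>x. X (x + t *\<^sub>R v) \<partial>lborel) has_real_derivative (\<integral>x. X' x \<partial>lborel)) (at 0)"
  proof (rule has_real_derivative_integral[where d = 1 and w = ?w])
    show "integrable lborel ?w"
      using borel_integrable_compact[of "cball a (r + norm v)" "\<lambda>_. L * norm v"] by simp
    fix t x assume t: "\<bar>t - 0\<bar> < (1::real)"
    show "\<bar>X (x + t *\<^sub>R v) - X (x + 0 *\<^sub>R v)\<bar> \<le> ?w x * \<bar>t - 0\<bar>"
    proof (cases "x \<in> cball a (r + norm v)")
      case True
      then show ?thesis using lip[of "x + t *\<^sub>R v" x] by (simp add: dist_norm mult.commute mult.left_commute)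
    next
      case False
      have "norm (t *\<^sub>R v) \<le> norm v" using t by (simp add: mult_left_le_one_le)
      moreover have "dist a x \<le> dist a (x + t *\<^sub>R v) + norm (t *\<^sub>R v)"
        using dist_triangle[of a x "x + t *\<^sub>R v"] by (simp add: dist_norm)
      ultimately have "x + t *\<^sub>R v \<notin> cball a r" "x \<notin> cball a r" using False norm_ge_zero[of v]
        unfolding mem_cball by linarith+
      then show ?thesis using False supp by simp
    qed
  qed (use intt der X' in auto)
  moreover have "((\<lambda>t. \<integral>x. X (x + t *\<^sub>R v) \<partial>lborel) has_real_derivative 0) (at 0)"
    unfolding eq by simp
  ultimately show ?thesis by (rule DERIV_unique)
qed

text \<open>
  By compactness the partial derivatives are bounded on the closed ball, and so is the operator norm
  of the derivative; the mean value inequality on the convex ball does the rest.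
\<close>

lemma C1_lipschitz_on_cball:
  fixes f :: "'a::euclidean_space \<Rightarrow> real"
  assumes f: "\<And>x. x \<in> S \<Longrightarrow> (f has_derivative f' x) (at x)"
    and f': "\<And>v. continuous_on S (\<lambda>x. f' x v)"
    and S: "cball a r \<subseteq> S"
  obtains L where "\<And>x y. x \<in> cball a r \<Longrightarrow> y \<in> cball a r \<Longrightarrow> \<bar>f x - f y\<bar> \<le> L * dist x y"
proof -
  have "\<exists>C. \<forall>x\<in>cball a r. \<bar>f' x b\<bar> \<le> C" for b
  proof -
    have "compact ((\<lambda>x. f' x b) ` cball a r)"
      by (rule compact_continuous_image[OF continuous_on_subset[OF f' S]]) simp
    then obtain C where "\<forall>y\<in>(\<lambda>x. f' x b) ` cball a r. norm y \<le> C"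
      using compact_imp_bounded bounded_iff by metis
    then show ?thesis by auto
  qed
  then obtain C where C: "\<And>b x. x \<in> cball a r \<Longrightarrow> \<bar>f' x b\<bar> \<le> C b" by metis
  have "onorm (f' x) \<le> (\<Sum>b\<in>Basis. C b)" if x: "x \<in> cball a r" for x
  proof (rule onorm_le)
    fix v
    interpret bounded_linear "f' x" using f x S by (blast intro: has_derivative_bounded_linear)
    have "f' x v = f' x (\<Sum>b\<in>Basis. (v \<bullet> b) *\<^sub>R b)" by (simp add: euclidean_representation)
    also have "\<dots> = (\<Sum>b\<in>Basis. (v \<bullet> b) * f' x b)" by (simp add: sum scaleR)
    also have "norm \<dots> \<le> (\<Sum>b\<in>Basis. C b * norm v)"
    proof (rule sum_norm_le)
      fix b :: 'a assume "b \<in> Basis"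
      then have "\<bar>v \<bullet> b\<bar> \<le> norm v" by (rule Basis_le_norm)
      then show "norm ((v \<bullet> b) * f' x b) \<le> C b * norm v"
        using C[OF x, of b] by (simp add: abs_mult mult.commute[of "C b"] mult_mono')
    qed
    finally show "norm (f' x v) \<le> (\<Sum>b\<in>Basis. C b) * norm v" by (simp add: sum_distrib_right)
  qed
  then have "norm (f x - f y) \<le> (\<Sum>b\<in>Basis. C b) * norm (x - y)"
    if "x \<in> cball a r" "y \<in> cball a r" for x y
    by (intro differentiable_bound[of "cball a r" f f'])
      (use that f S in \<open>auto intro: has_derivative_at_withinI simp del: mem_cball\<close>)
  then show thesis by (intro that[of "\<Sum>b\<in>Basis. C b"]) (simp add: dist_norm)
qed

text \<open>
  A \<open>C\<^sup>1\<close> function that vanishes on the sphere stays Lipschitz when it is extended by zero, because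
  the extension is the composition with the nearest-point projection onto the closed ball, which
  does not increase distances. The extension is differentiable off the sphere, a null set, so the
  previous translation argument applies to it.
\<close>

lemma set_integral_directional_derivative_eq_0:
  fixes X :: "'a::euclidean_space \<Rightarrow> real"
  assumes X: "\<And>x. x \<in> S \<Longrightarrow> (X has_derivative D x) (at x)"
    and D: "\<And>v. continuous_on S (\<lambda>x. D x v)"
    and r: "0 < r" "cball a r \<subseteq> S"
    and zero: "\<And>x. x \<in> sphere a r \<Longrightarrow> X x = 0"
  shows "(LINT x:ball a r|lborel. D x v) = 0"
proof -
  obtain L where L: "\<And>x y. x \<in> cball a r \<Longrightarrow> y \<in> cball a r \<Longrightarrow> \<bar>X x - X y\<bar> \<le> L * dist x y"
    using C1_lipschitz_on_cball[OF X D r(2)] by blast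
  have L0: "L \<ge> 0"
  proof -
    obtain b :: 'a where b: "b \<in> Basis" using nonempty_Basis by blast
    have "0 \<le> \<bar>X (a + r *\<^sub>R b) - X a\<bar>" by simp
    also have "\<dots> \<le> L * dist (a + r *\<^sub>R b) a" using b r by (intro L) (auto simp: dist_norm)
    also have "\<dots> = L * r" using b r by (simp add: dist_norm)
    finally show ?thesis using r by (simp add: zero_le_mult_iff)
  qed
  let ?p = "closest_point (cball a r)"
  have ne: "cball a r \<noteq> {}" using r by auto
  have p_in: "?p x \<in> cball a r" for x by (rule closest_point_in_set) (use ne in auto)
  \<comment> \<open>Points outside the closed ball are projected to the sphere, where \<open>X\<close> vanishes.\<close>
  define Y where "Y = (\<lambda>x. X (?p x))"
  have Yin: "Y x = X x" if "x \<in> cball a r" for x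
    using that by (simp add: Y_def closest_point_self)
  have Yout: "Y x = 0" if "x \<notin> cball a r" for x
  proof -
    have "interior (cball a r) \<noteq> {}" using r by auto
    then have "x \<in> affine hull cball a r - rel_interior (cball a r)"
      using that r by (simp add: affine_hull_nonempty_interior rel_interior_nonempty_interior)
    then have "?p x \<in> rel_frontier (cball a r)"
      using ne by (intro closest_point_in_rel_frontier) auto
    then show ?thesis using zero r by (simp add: Y_def)
  qed
  have "(\<integral>x. indicator (ball a r) x *\<^sub>R D x v \<partial>lborel) = 0"
  proof (rule integral_directional_derivative_eq_0[where X = Y and v = v])
    fix x y
    have "\<bar>Y x - Y y\<bar> \<le> L * dist (?p x) (?p y)" unfolding Y_def by (intro L p_in)
    also have "\<dots> \<le> L * dist x y"
      by (intro mult_left_mono closest_point_lipschitz) (use ne L0 in auto)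
    finally show "\<bar>Y x - Y y\<bar> \<le> L * dist x y" .
  next
    show "(\<lambda>x. indicator (ball a r) x *\<^sub>R D x v) \<in> borel_measurable borel"
      by (rule borel_measurable_continuous_on_indicator)
        (simp, rule continuous_on_subset[OF D order_trans[OF ball_subset_cball r(2)]])
    have "sphere a r \<in> null_sets lborel"
      using negligible_sphere[of a r] by (simp add: negligible_iff_null_sets null_sets_completion_iff)
    then have "AE x in lborel. x \<notin> sphere a r" by (rule AE_not_in)
    then show "AE x in lborel. ((\<lambda>t. Y (x + t *\<^sub>R v)) has_real_derivative
        indicator (ball a r) x *\<^sub>R D x v) (at 0)"
    proof eventually_elim
      case (elim x)
      have near: "\<forall>\<^sub>F t in nhds (0::real). x + t *\<^sub>R v \<in> U" if "open U" "x \<in> U" for U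
      proof -
        have "open ((\<lambda>t::real. x + t *\<^sub>R v) -` U)"
          by (intro open_vimage that continuous_intros)
        from eventually_nhds_in_open[OF this, of 0] that show ?thesis by simp
      qed
      consider "x \<in> ball a r" | "x \<in> - cball a r" using elim by force
      then show ?case
      proof cases
        case 1
        then have xS: "x \<in> S" using r(2) ball_subset_cball by blast
        have "((\<lambda>t. x + t *\<^sub>R v) has_derivative (\<lambda>t. t *\<^sub>R v)) (at (0::real))"
          by (auto intro!: derivative_eq_intros)
        moreover have "(X has_derivative D x) (at (x + 0 *\<^sub>R v))" using X[OF xS] by simp
        ultimately have "((\<lambda>t. X (x + t *\<^sub>R v)) has_derivative (\<lambda>t. D x (t *\<^sub>R v))) (at 0)"
          by (rule has_derivative_compose)
        moreover have "D x (t *\<^sub>R v) = D x v * t" for t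
          using linear_cmul[OF has_derivative_linear[OF X[OF xS]], of t v] by (simp add: mult.commute)
        ultimately have XD: "((\<lambda>t. X (x + t *\<^sub>R v)) has_real_derivative D x v) (at 0)"
          by (simp add: has_field_derivative_def)
        have "\<forall>\<^sub>F t in nhds (0::real). x + t *\<^sub>R v \<in> ball a r"
          using 1 by (intro near) auto
        then have "\<forall>\<^sub>F t in nhds (0::real). X (x + t *\<^sub>R v) = Y (x + t *\<^sub>R v)"
          by (elim eventually_mono) (simp add: Yin)
        from DERIV_cong_ev[OF refl this refl, THEN iffD1, OF XD] 1 show ?thesis by simp
      next
        case 2
        have "\<forall>\<^sub>F t in nhds (0::real). x + t *\<^sub>R v \<in> - cball a r"
          using 2 by (intro near) auto
        then have "\<forall>\<^sub>F t in nhds (0::real). 0 = Y (x + t *\<^sub>R v)"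
          by (elim eventually_mono) (simp add: Yout)
        from DERIV_cong_ev[OF refl this refl, THEN iffD1, OF DERIV_const]
        have "((\<lambda>t. Y (x + t *\<^sub>R v)) has_real_derivative 0) (at 0)" .
        moreover have "x \<notin> ball a r" using 2 by auto
        ultimately show ?thesis by simp
      qed
    qed
  qed (rule Yout)
  then show ?thesis by (simp add: set_lebesgue_integral_def)
qed

section \<open>Mean values of harmonic functions\<close>

text \<open>
  With \<open>\<phi> x = (r\<^sup>2 - |x - a|\<^sup>2) / 2\<close>, which vanishes on the sphere and has gradient \<open>a - x\<close>, the
  divergence of \<open>\<phi> \<nabla>h\<close> is \<open>\<phi> \<Delta>h - \<nabla>h \<bullet> (x - a)\<close>. Its integral over the ball is zero, and for harmonic
  \<open>h\<close> only the second term is left.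
\<close>

lemma set_integral_radial_derivative_harmonic:
  fixes h :: "'a::euclidean_space \<Rightarrow> real"
  assumes g: "\<And>x. x \<in> S \<Longrightarrow> GDERIV h x :> g x"
    and H: "\<And>x. x \<in> S \<Longrightarrow> (g has_derivative H x) (at x)"
    and Hc: "\<And>v. continuous_on S (\<lambda>x. H x v)"
    and tr: "\<And>x. x \<in> S \<Longrightarrow> (\<Sum>b\<in>Basis. H x b \<bullet> b) = 0"
    and r: "0 < r" "cball a r \<subseteq> S"
  shows "(LINT x:ball a r|lborel. g x \<bullet> (x - a)) = 0"
proof -
  let ?\<phi> = "\<lambda>x. (r\<^sup>2 - (x - a) \<bullet> (x - a)) / 2"
  define D where "D = (\<lambda>b x v. ?\<phi> x * (H x v \<bullet> b) - ((x - a) \<bullet> v) * (g x \<bullet> b))"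
  have gc: "continuous_on S g"
    using H by (intro continuous_at_imp_continuous_on) (auto intro: has_derivative_continuous)
  have Dc: "continuous_on S (\<lambda>x. D b x v)" for b v
    unfolding D_def by (intro continuous_intros Hc gc) auto
  have Dint: "set_integrable lborel (ball a r) (\<lambda>x. D b x v)" for b v
    by (rule set_integrable_continuous_cball[OF continuous_on_subset[OF Dc r(2)]]) auto
  have zero: "(LINT x:ball a r|lborel. D b x v) = 0" for b v
  proof (rule set_integral_directional_derivative_eq_0[where X = "\<lambda>x. ?\<phi> x * (g x \<bullet> b)" and S = S])
    show "((\<lambda>x. ?\<phi> x * (g x \<bullet> b)) has_derivative D b x) (at x)" if "x \<in> S" for x
    proof -
      have "((\<lambda>x. ?\<phi> x) has_derivative (\<lambda>v. - ((x - a) \<bullet> v))) (at x)"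
        by (auto intro!: derivative_eq_intros simp: fun_eq_iff inner_commute field_simps)
      from has_derivative_mult[OF this has_derivative_inner_left[OF H[OF that]]]
      show ?thesis by (simp add: D_def fun_eq_iff algebra_simps)
    qed
    show "?\<phi> x * (g x \<bullet> b) = 0" if "x \<in> sphere a r" for x
      using that by (simp add: dist_norm norm_minus_commute flip: power2_norm_eq_inner)
  qed (use Dc r in auto)
  have "(\<Sum>b\<in>Basis. D b x b) = - (g x \<bullet> (x - a))" if "x \<in> S" for x
  proof -
    have "(\<Sum>b\<in>Basis. D b x b)
        = ?\<phi> x * (\<Sum>b\<in>Basis. H x b \<bullet> b) - (\<Sum>b\<in>Basis. ((x - a) \<bullet> b) * (g x \<bullet> b))"
      by (simp add: D_def sum_subtractf sum_distrib_left)
    also have "(\<Sum>b\<in>Basis. ((x - a) \<bullet> b) * (g x \<bullet> b)) = g x \<bullet> (x - a)"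
      by (simp only: euclidean_inner[of "x - a" "g x", symmetric]) (rule inner_commute)
    finally show ?thesis using tr[OF that] by simp
  qed
  then have "(LINT x:ball a r|lborel. g x \<bullet> (x - a))
      = (LINT x:ball a r|lborel. - (\<Sum>b\<in>Basis. D b x b))"
    using r by (intro set_lebesgue_integral_cong) (auto simp: subset_eq)
  also have "\<dots> = - (\<Sum>b\<in>Basis. LINT x:ball a r|lborel. D b x b)"
    using Dint unfolding set_lebesgue_integral_def set_integrable_def
    by (simp only: scaleR_sum_right scaleR_minus_right integral_minus Bochner_Integration.integral_sum)
  finally show ?thesis by (simp add: zero)
qed

lemma harmonic_on_continuous_on: "harmonic_on h S \<Longrightarrow> continuous_on S h"
  unfolding harmonic_on_def gderiv_def
  by (metis continuous_at_imp_continuous_on has_derivative_continuous)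

text \<open>
  The mean of \<open>h\<close> over the ball of radius \<open>s\<close>, multiplied by the volume of the unit ball, is the integral
  \<open>A s\<close> of \<open>x \<mapsto> h (a + s x)\<close> over the unit ball. Its derivative at \<open>r\<close> is the integral of
  \<open>\<nabla>h (a + r x) \<bullet> x\<close>, which vanishes by the integral identity for \<open>\<nabla>h \<bullet> (x - a)\<close> above. So the ball integral \<open>s\<^sup>n A s\<close> has derivative \<open>n r\<^sup>n\<^sup>-\<^sup>1 A r\<close> at \<open>r\<close>. The shell estimate gives
  \<open>n r\<^sup>n\<^sup>-\<^sup>1\<close> times the radial integral for the same derivative, and the two must agree.
\<close>

lemma harmonic_ball_eq_sphere:
  fixes h :: "'a::euclidean_space \<Rightarrow> real"
  assumes h: "harmonic_on h S" and r: "0 < r" "r < R" and S: "cball a R \<subseteq> S"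
  shows "(LINT x:ball a r|lborel. h x) = r ^ DIM('a) * radial_integral h a r"
proof -
  let ?n = "DIM('a)"
  obtain g H where g: "\<And>x. x \<in> S \<Longrightarrow> GDERIV h x :> g x"
    and H: "\<And>x. x \<in> S \<Longrightarrow> (g has_derivative H x) (at x)"
    and Hc: "\<And>v. continuous_on S (\<lambda>x. H x v)"
    and tr: "\<And>x. x \<in> S \<Longrightarrow> (\<Sum>b\<in>Basis. H x b \<bullet> b) = 0"
    using h unfolding harmonic_on_def by blast
  have gc: "continuous_on S g"
    using H by (intro continuous_at_imp_continuous_on) (auto intro: has_derivative_continuous)
  have hd: "(h has_derivative (\<lambda>v. g x \<bullet> v)) (at x)" if "x \<in> S" for x
    using g[OF that] by (simp add: gderiv_def inner_commute)
  obtain L where L: "\<And>x y. x \<in> cball a R \<Longrightarrow> y \<in> cball a R \<Longrightarrow> \<bar>h x - h y\<bar> \<le> L * dist x y"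
  proof (rule C1_lipschitz_on_cball[of S h "\<lambda>x v. g x \<bullet> v" a R])
    show "continuous_on S (\<lambda>x. g x \<bullet> v)" for v by (intro continuous_intros gc)
  qed (use hd S that in blast)+
  have hc: "continuous_on (cball a R) h"
    using harmonic_on_continuous_on[OF h] S by (rule continuous_on_subset)
  have hm: "set_borel_measurable lborel (ball a s) h" if "s \<le> R" for s
  proof -
    have "set_integrable lborel (ball a s) h"
      by (rule set_integrable_continuous_cball[OF hc order_trans[OF ball_subset_cball subset_cball[OF that]]]) simp
    then show ?thesis
      unfolding set_integrable_def set_borel_measurable_def by (rule borel_measurable_integrable)
  qed
  \<comment> \<open>The radius is moved from the domain of integration into the integrand,
    so that it can be differentiated under the integral sign.\<close>
  define A where "A = (\<lambda>s. LINT x:ball 0 1|lborel. h (a + s *\<^sub>R x))"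
  have in_ball: "a + s *\<^sub>R x \<in> ball a R" if "x \<in> ball 0 1" "0 \<le> s" "s \<le> R" "0 < R" for s x
  proof -
    have "s * norm x \<le> R * norm x" using that by (intro mult_right_mono) auto
    also have "\<dots> < R * 1" using that by (intro mult_strict_left_mono) auto
    finally show ?thesis using that by (simp add: dist_norm)
  qed
  have F: "(LINT x:ball a s|lborel. h x) = s ^ ?n * A s" if "0 < s" "s \<le> R" for s
    unfolding A_def using that by (intro set_integral_ball_scale hm)
  have A': "(A has_real_derivative 0) (at r)"
  proof -
    have comp: "continuous_on (cball 0 1) (\<lambda>x. k (a + s *\<^sub>R x))"
      if "continuous_on (cball a R) k" "0 < s" "s \<le> R" for k :: "'a \<Rightarrow> real" and s
    proof (rule continuous_on_compose2[OF that(1)])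
      show "(\<lambda>x. a + s *\<^sub>R x) ` cball 0 1 \<subseteq> cball a R"
        using that mult_mono[of s R "norm _" 1] by (auto simp: dist_norm)
    qed (intro continuous_intros)
    have "((\<lambda>s. \<integral>x. indicator (ball 0 1) x *\<^sub>R h (a + s *\<^sub>R x) \<partial>lborel) has_real_derivative
        (\<integral>x. indicator (ball 0 1) x *\<^sub>R (g (a + r *\<^sub>R x) \<bullet> x) \<partial>lborel)) (at r)"
    proof (rule has_real_derivative_integral[where d = "min r (R - r)"
        and w = "\<lambda>x. indicator (ball 0 1) x *\<^sub>R \<bar>L\<bar>"])
      show "0 < min r (R - r)" using r by simp
      show "integrable lborel (\<lambda>x. indicator (ball 0 1) x *\<^sub>R h (a + t *\<^sub>R x))"
        if "\<bar>t - r\<bar> < min r (R - r)" for t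
        using set_integrable_continuous_cball[OF comp[OF hc], of t "ball 0 1"] that
        by (auto simp: set_integrable_def)
      show "integrable lborel (\<lambda>x::'a. indicator (ball 0 1) x *\<^sub>R \<bar>L\<bar>)"
        using set_integrable_continuous_cball[of "0::'a" 1 "\<lambda>_. \<bar>L\<bar>" "ball 0 1"]
        by (auto simp: set_integrable_def)
      have gi: "continuous_on (ball 0 1) (\<lambda>x. g (a + r *\<^sub>R x) \<bullet> x)"
        by (intro continuous_intros continuous_on_compose2[OF gc])
          (use r S in_ball[of _ r] in fastforce)
      show "(\<lambda>x. indicator (ball 0 1) x *\<^sub>R (g (a + r *\<^sub>R x) \<bullet> x)) \<in> borel_measurable lborel"
        using borel_measurable_continuous_on_indicator[OF _ gi] by simp
    next
      fix t x assume t: "\<bar>t - r\<bar> < min r (R - r)"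
      show "\<bar>indicator (ball 0 1) x *\<^sub>R h (a + t *\<^sub>R x) - indicator (ball 0 1) x *\<^sub>R h (a + r *\<^sub>R x)\<bar>
          \<le> indicator (ball 0 1) x *\<^sub>R \<bar>L\<bar> * \<bar>t - r\<bar>"
      proof (cases "x \<in> ball 0 1")
        case True
        have "\<bar>h (a + t *\<^sub>R x) - h (a + r *\<^sub>R x)\<bar> \<le> L * dist (a + t *\<^sub>R x) (a + r *\<^sub>R x)"
          using True t r ball_subset_cball[of a R] by (intro L subsetD[OF ball_subset_cball] in_ball) auto
        also have "dist (a + t *\<^sub>R x) (a + r *\<^sub>R x) = \<bar>t - r\<bar> * norm x"
          by (simp add: dist_norm flip: scaleR_left_diff_distrib)
        also have "L * (\<bar>t - r\<bar> * norm x) \<le> \<bar>L\<bar> * (\<bar>t - r\<bar> * 1)"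
          using True by (intro mult_mono) (auto intro: mult_left_le)
        finally show ?thesis using True by simp
      qed simp
    next
      have "((\<lambda>t. indicator (ball 0 1) x *\<^sub>R h (a + t *\<^sub>R x)) has_real_derivative
          indicator (ball 0 1) x *\<^sub>R (g (a + r *\<^sub>R x) \<bullet> x)) (at r)" for x
      proof (cases "x \<in> ball 0 1")
        case True
        have "((\<lambda>t. a + t *\<^sub>R x) has_derivative (\<lambda>t. t *\<^sub>R x)) (at r)"
          by (auto intro!: derivative_eq_intros)
        moreover have "(h has_derivative (\<lambda>v. g (a + r *\<^sub>R x) \<bullet> v)) (at (a + r *\<^sub>R x))"
          using in_ball[OF True, of r] r S by (intro hd) auto
        ultimately have "((\<lambda>t. h (a + t *\<^sub>R x)) has_derivative (\<lambda>t. g (a + r *\<^sub>R x) \<bullet> (t *\<^sub>R x))) (at r)"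
          by (rule has_derivative_compose)
        then show ?thesis using True by (simp add: has_field_derivative_def mult_commute_abs)
      qed simp
      then show "AE x in lborel. ((\<lambda>t. indicator (ball 0 1) x *\<^sub>R h (a + t *\<^sub>R x)) has_real_derivative
          indicator (ball 0 1) x *\<^sub>R (g (a + r *\<^sub>R x) \<bullet> x)) (at r)" by simp
    qed
    moreover have "(\<integral>x. indicator (ball 0 1) x *\<^sub>R (g (a + r *\<^sub>R x) \<bullet> x) \<partial>lborel) = 0"
    proof -
      have sub: "cball a r \<subseteq> S" using S r by auto
      have "continuous_on (cball a r) (\<lambda>x. g x \<bullet> (x - a))"
        by (intro continuous_intros continuous_on_subset[OF gc sub])
      from set_integrable_continuous_cball[OF this, of "ball a r"]
      have m: "set_borel_measurable lborel (ball a r) (\<lambda>x. g x \<bullet> (x - a))"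
        by (auto simp: set_integrable_def set_borel_measurable_def)
      have "0 = (LINT x:ball a r|lborel. g x \<bullet> (x - a))"
        using set_integral_radial_derivative_harmonic[OF g H Hc tr r(1) sub] by simp
      also have "\<dots> = r ^ ?n * (LINT x:ball 0 1|lborel. r * (g (a + r *\<^sub>R x) \<bullet> x))"
        by (subst set_integral_ball_scale[OF r(1) m]) simp
      finally show ?thesis using r by (simp add: set_lebesgue_integral_def)
    qed
    ultimately show ?thesis by (simp add: A_def set_lebesgue_integral_def)
  qed
  have prod: "((\<lambda>s. s ^ ?n * A s) has_real_derivative real ?n * r ^ (?n - 1) * A r) (at r)"
    by (rule DERIV_cong, (rule derivative_intros A')+) simp
  have "\<forall>\<^sub>F s in nhds r. (LINT x:ball a s|lborel. h x) = s ^ ?n * A s"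
    using eventually_nhds_in_open[of "{0<..<R}" r] r
    by (auto elim!: eventually_mono simp: F)
  from DERIV_cong_ev[OF refl this refl, THEN iffD2, OF prod]
  have "((\<lambda>s. LINT x:ball a s|lborel. h x) has_real_derivative
      real ?n * r ^ (?n - 1) * A r) (at r)" .
  from DERIV_unique[OF this has_real_derivative_ball_integral[OF r hc]]
  have "radial_integral h a r = A r" using r by simp
  then show ?thesis using F[of r] r by simp
qed

section \<open>Density of harmonic functions on a sphere\<close>

text \<open>
  The definition of harmonicity on the whole space with an arbitrary Laplacian \<open>L\<close> in place of zero.
  It makes it possible to compute Laplacians of single terms and to let them cancel in sums.
\<close>

definition has_laplacian :: "('a::euclidean_space \<Rightarrow> real) \<Rightarrow> ('a \<Rightarrow> real) \<Rightarrow> bool" where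
  "has_laplacian f L \<longleftrightarrow>
     (\<exists>g H. (\<forall>x. GDERIV f x :> g x) \<and> (\<forall>x. (g has_derivative H x) (at x)) \<and>
        (\<forall>v. continuous_on UNIV (\<lambda>x. H x v)) \<and> (\<forall>x. (\<Sum>b\<in>Basis. H x b \<bullet> b) = L x))"

lemma harmonic_on_UNIV_iff: "harmonic_on h UNIV \<longleftrightarrow> has_laplacian h (\<lambda>_. 0)"
  by (simp add: harmonic_on_def has_laplacian_def)

lemma has_laplacian_add:
  fixes f f' :: "'a::euclidean_space \<Rightarrow> real"
  assumes "has_laplacian f L" "has_laplacian f' L'"
  shows "has_laplacian (\<lambda>x. f x + f' x) (\<lambda>x. L x + L' x)"
proof -
  obtain g H g' H' where
    "\<forall>x. GDERIV f x :> g x" "\<forall>x. (g has_derivative H x) (at x)"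
    "\<forall>v. continuous_on UNIV (\<lambda>x. H x v)" "\<forall>x. (\<Sum>b\<in>Basis. H x b \<bullet> b) = L x"
    "\<forall>x. GDERIV f' x :> g' x" "\<forall>x. (g' has_derivative H' x) (at x)"
    "\<forall>v. continuous_on UNIV (\<lambda>x. H' x v)" "\<forall>x. (\<Sum>b\<in>Basis. H' x b \<bullet> b) = L' x"
    using assms unfolding has_laplacian_def by blast
  then show ?thesis
    unfolding has_laplacian_def
    by (intro exI[of _ "\<lambda>x. g x + g' x"] exI[of _ "\<lambda>x v. H x v + H' x v"])
      (auto intro!: GDERIV_add has_derivative_add continuous_on_add simp: inner_add_left sum.distrib)
qed

lemma has_laplacian_cmult:
  fixes f :: "'a::euclidean_space \<Rightarrow> real"
  assumes "has_laplacian f L"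
  shows "has_laplacian (\<lambda>x. c * f x) (\<lambda>x. c * L x)"
proof -
  obtain g H where gH:
    "\<forall>x. GDERIV f x :> g x" "\<forall>x. (g has_derivative H x) (at x)"
    "\<forall>v. continuous_on UNIV (\<lambda>x. H x v)" "\<forall>x. (\<Sum>b\<in>Basis. H x b \<bullet> b) = L x"
    using assms unfolding has_laplacian_def by blast
  have "GDERIV (\<lambda>x. c * f x) x :> c *\<^sub>R g x" for x
    using GDERIV_mult[OF GDERIV_const gH(1)[rule_format], of c x] by simp
  with gH show ?thesis
    unfolding has_laplacian_def
    by (intro exI[of _ "\<lambda>x. c *\<^sub>R g x"] exI[of _ "\<lambda>x v. c *\<^sub>R H x v"])
      (auto intro!: has_derivative_scaleR_right continuous_on_scaleR simp flip: sum_distrib_left)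
qed

lemma has_laplacian_zero: "has_laplacian (\<lambda>x. 0) (\<lambda>x. 0)"
  unfolding has_laplacian_def
  by (intro exI[of _ "\<lambda>x. 0"] exI[of _ "\<lambda>x v. 0"]) (auto intro: GDERIV_const)

lemma has_laplacian_sum:
  assumes "\<And>i. i \<in> I \<Longrightarrow> has_laplacian (f i) (L i)"
  shows "has_laplacian (\<lambda>x. \<Sum>i\<in>I. f i x) (\<lambda>x. \<Sum>i\<in>I. L i x)"
  using assms by (induction I rule: infinite_finite_induct)
    (auto intro: has_laplacian_zero has_laplacian_add)

lemma harmonic_on_UNIV_add:
  assumes "harmonic_on h UNIV" "harmonic_on h' UNIV"
  shows "harmonic_on (\<lambda>x. h x + h' x) UNIV"
  using has_laplacian_add assms unfolding harmonic_on_UNIV_iff by fastforce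

lemma harmonic_on_UNIV_sum:
  assumes "\<And>i. i \<in> I \<Longrightarrow> harmonic_on (f i) UNIV"
  shows "harmonic_on (\<lambda>x. \<Sum>i\<in>I. c i * f i x) UNIV"
  using has_laplacian_sum[of I "\<lambda>i x. c i * f i x" "\<lambda>_ _. 0"] assms has_laplacian_cmult
  unfolding harmonic_on_UNIV_iff by fastforce

text \<open>
  Here \<open>\<nabla>s = v\<close> and \<open>\<nabla>t = 2 (x - a)\<close>, hence \<open>\<nabla>s \<bullet> \<nabla>s = v \<bullet> v\<close>, \<open>\<nabla>s \<bullet> \<nabla>t = 2 s\<close>, \<open>\<nabla>t \<bullet> \<nabla>t = 4 t\<close>,
  \<open>\<Delta>s = 0\<close> and \<open>\<Delta>t = 2 n\<close>, so the Laplacian of a polynomial in \<open>s\<close> and \<open>t\<close> is again one. The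
  truncated exponents are harmless: each comes with a factor that vanishes when truncation occurs.
\<close>

lemma has_laplacian_ridge_times_radial:
  fixes a v :: "'a::euclidean_space"
  defines "s \<equiv> \<lambda>x. (x - a) \<bullet> v" and "t \<equiv> \<lambda>x. (x - a) \<bullet> (x - a)"
  shows "has_laplacian (\<lambda>x. s x ^ p * t x ^ q)
    (\<lambda>x. real (p * (p - 1)) * (v \<bullet> v) * (s x ^ (p - 2) * t x ^ q)
       + real (2 * q * (2 * p + 2 * (q - 1) + DIM('a))) * (s x ^ p * t x ^ (q - 1)))"
proof -
  define A where "A = (\<lambda>x. real p * s x ^ (p - 1) * t x ^ q)"
  define B where "B = (\<lambda>x. 2 * real q * s x ^ p * t x ^ (q - 1))"
  define DA where "DA = (\<lambda>x w. real p * real (p - 1) * s x ^ (p - 2) * t x ^ q * (v \<bullet> w)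
     + 2 * real p * real q * s x ^ (p - 1) * t x ^ (q - 1) * ((x - a) \<bullet> w))"
  define DB where "DB = (\<lambda>x w. 2 * real p * real q * s x ^ (p - 1) * t x ^ (q - 1) * (v \<bullet> w)
     + 4 * real q * real (q - 1) * s x ^ p * t x ^ (q - 2) * ((x - a) \<bullet> w))"
  define g where "g = (\<lambda>x. A x *\<^sub>R v + B x *\<^sub>R (x - a))"
  define H where "H = (\<lambda>x w. DA x w *\<^sub>R v + DB x w *\<^sub>R (x - a) + B x *\<^sub>R w)"
  have s': "(s has_derivative (\<lambda>w. v \<bullet> w)) (at x)" for x
    unfolding s_def by (auto intro!: derivative_eq_intros simp: inner_commute)
  have t': "(t has_derivative (\<lambda>w. 2 * ((x - a) \<bullet> w))) (at x)" for x
    unfolding t_def by (auto intro!: derivative_eq_intros simp: inner_commute)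
  have st: "((\<lambda>x. s x ^ i * t x ^ j) has_derivative
      (\<lambda>w. real i * s x ^ (i - 1) * t x ^ j * (v \<bullet> w)
        + 2 * real j * s x ^ i * t x ^ (j - 1) * ((x - a) \<bullet> w))) (at x)" for i j x
    by (rule has_derivative_eq_rhs, (rule derivative_intros s' t')+) (simp add: fun_eq_iff algebra_simps)
  have 1: "GDERIV (\<lambda>x. s x ^ p * t x ^ q) x :> g x" for x
    unfolding gderiv_def g_def
    by (rule has_derivative_eq_rhs[OF st]) (simp add: fun_eq_iff A_def B_def inner_add_right inner_commute)
  have A': "(A has_derivative DA x) (at x)" for x
    unfolding A_def using has_derivative_mult_right[OF st[of "p - 1" q x], of "real p"]
    by (simp add: DA_def algebra_simps numeral_2_eq_2)
  have B': "(B has_derivative DB x) (at x)" for x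
    unfolding B_def using has_derivative_mult_right[OF st[of p "q - 1" x], of "2 * real q"]
    by (simp add: DB_def algebra_simps numeral_2_eq_2)
  have 2: "(g has_derivative H x) (at x)" for x
    unfolding g_def H_def
    by (rule has_derivative_eq_rhs, (rule derivative_intros A' B')+) (simp add: fun_eq_iff algebra_simps)
  have 3: "continuous_on UNIV (\<lambda>x. H x w)" for w
    unfolding H_def DA_def DB_def B_def s_def t_def by (intro continuous_intros)
  have 4: "(\<Sum>b\<in>Basis. H x b \<bullet> b) = real (p * (p - 1)) * (v \<bullet> v) * (s x ^ (p - 2) * t x ^ q)
       + real (2 * q * (2 * p + 2 * (q - 1) + DIM('a))) * (s x ^ p * t x ^ (q - 1))" for x
  proof -
    define C1 where "C1 = real p * real (p - 1) * s x ^ (p - 2) * t x ^ q"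
    define C2 where "C2 = 2 * real p * real q * s x ^ (p - 1) * t x ^ (q - 1)"
    define C3 where "C3 = 4 * real q * real (q - 1) * s x ^ p * t x ^ (q - 2)"
    have sum: "(\<Sum>b\<in>Basis. (y \<bullet> b) * (z \<bullet> b)) = y \<bullet> z" for y z :: 'a
      by (simp add: euclidean_inner[of y z])
    have "H x b \<bullet> b = C1 * ((v \<bullet> b) * (v \<bullet> b)) + 2 * C2 * ((v \<bullet> b) * ((x - a) \<bullet> b))
        + C3 * (((x - a) \<bullet> b) * ((x - a) \<bullet> b)) + B x" if "b \<in> Basis" for b
      using that unfolding H_def DA_def DB_def C1_def[symmetric] C2_def[symmetric] C3_def[symmetric]
      by (simp add: inner_add_left algebra_simps)
    then have "(\<Sum>b\<in>Basis. H x b \<bullet> b)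
        = C1 * (v \<bullet> v) + 2 * C2 * (v \<bullet> (x - a)) + C3 * ((x - a) \<bullet> (x - a)) + real DIM('a) * B x"
      by (simp add: sum.distrib sum flip: sum_distrib_left)
    also have "\<dots> = C1 * (v \<bullet> v) + 2 * (C2 * s x) + C3 * t x + real DIM('a) * B x"
      by (simp add: s_def t_def inner_commute)
    also have "C2 * s x = 2 * real p * real q * s x ^ p * t x ^ (q - 1)"
      by (cases p) (auto simp: C2_def algebra_simps)
    also have "C3 * t x = 4 * real q * real (q - 1) * s x ^ p * t x ^ (q - 1)"
    proof (cases "q \<le> 1")
      case True
      then show ?thesis by (cases q) (auto simp: C3_def)
    next
      case False
      then obtain j where "q = Suc (Suc j)" by (metis Suc_le_D not_less_eq_eq One_nat_def)
      then show ?thesis by (simp add: C3_def algebra_simps)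
    qed
    finally show ?thesis
      unfolding C1_def B_def of_nat_mult of_nat_add of_nat_numeral by (simp add: algebra_simps)
  qed
  show ?thesis
    unfolding has_laplacian_def using 1 2 3 4 by blast
qed

text \<open>
  The coefficients of \<open>s\<^bsup>k - 2 j\<^esup> t\<^sup>j\<close> in the harmonic homogeneous polynomial of degree \<open>k\<close> with leading
  term \<open>s\<^sup>k\<close>, where \<open>s\<close> is the inner product of \<open>x - a\<close> with a vector \<open>v\<close>, \<open>t\<close> is the squared norm of \<open>x - a\<close>, 
  \<open>w = v \<bullet> v\<close>, and \<open>n\<close> is the dimension. The recursion makes the two contributions to each monomial of the Laplacian cancel.
\<close>

fun zonal_coeff :: "nat \<Rightarrow> nat \<Rightarrow> real \<Rightarrow> nat \<Rightarrow> real" where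
  "zonal_coeff n k w 0 = 1"
| "zonal_coeff n k w (Suc j) = - zonal_coeff n k w j * real ((k - 2 * j) * (k - 2 * j - 1)) * w
     / real (2 * Suc j * (2 * (k - 2 * Suc j) + 2 * j + n))"

lemma harmonic_zonal_polynomial:
  fixes a v :: "'a::euclidean_space"
  shows "harmonic_on (\<lambda>x. \<Sum>j\<le>k div 2. zonal_coeff DIM('a) k (v \<bullet> v) j *
    (((x - a) \<bullet> v) ^ (k - 2 * j) * ((x - a) \<bullet> (x - a)) ^ j)) UNIV"
proof -
  let ?m = "k div 2" and ?c = "zonal_coeff DIM('a) k (v \<bullet> v)"
  define A where "A = (\<lambda>x j. ?c j * real ((k - 2 * j) * (k - 2 * j - 1)) * (v \<bullet> v)
    * (((x - a) \<bullet> v) ^ (k - 2 * j - 2) * ((x - a) \<bullet> (x - a)) ^ j))"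
  define B where "B = (\<lambda>x j. ?c j * real (2 * j * (2 * (k - 2 * j) + 2 * (j - 1) + DIM('a)))
    * (((x - a) \<bullet> v) ^ (k - 2 * j) * ((x - a) \<bullet> (x - a)) ^ (j - 1)))"
  have "(\<Sum>j\<le>?m. A x j + B x j) = 0" for x
  proof -
    have Am: "A x ?m = 0"
    proof -
      have "k - 2 * ?m = 0 \<or> k - 2 * ?m = 1" by presburger
      then show ?thesis by (auto simp: A_def)
    qed
    have B0: "B x 0 = 0" by (simp add: B_def)
    have AB: "A x j + B x (Suc j) = 0" for j
    proof -
      define d where "d = real (2 * Suc j * (2 * (k - 2 * Suc j) + 2 * j + DIM('a)))"
      have d: "d \<noteq> 0" unfolding d_def by (simp only: of_nat_eq_0_iff) simp
      have "B x (Suc j) = (?c (Suc j) * d) * (((x - a) \<bullet> v) ^ (k - 2 * j - 2) * ((x - a) \<bullet> (x - a)) ^ j)"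
        by (simp add: B_def d_def del: zonal_coeff.simps of_nat_mult of_nat_add of_nat_Suc)
      also have "?c (Suc j) * d = - ?c j * real ((k - 2 * j) * (k - 2 * j - 1)) * (v \<bullet> v)"
        using d by (simp only: zonal_coeff.simps d_def[symmetric] nonzero_divide_eq_eq[symmetric]) simp
      finally show ?thesis by (simp add: A_def)
    qed
    have "(\<Sum>j\<le>?m. A x j + B x j) = (\<Sum>j\<le>?m. A x j) + (\<Sum>j\<le>?m. B x j)"
      by (rule sum.distrib)
    also have "(\<Sum>j\<le>?m. A x j) = (\<Sum>j<?m. A x j)"
      by (simp only: lessThan_Suc_atMost[symmetric] sum.lessThan_Suc Am add_0_right)
    also have "(\<Sum>j\<le>?m. B x j) = (\<Sum>j<?m. B x (Suc j))"
      by (simp add: sum.atMost_shift B0)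
    finally have "(\<Sum>j\<le>?m. A x j + B x j) = (\<Sum>j<?m. A x j + B x (Suc j))"
      by (simp add: sum.distrib)
    then show ?thesis by (simp add: AB)
  qed
  moreover have "has_laplacian (\<lambda>x. \<Sum>j\<le>?m. ?c j * (((x - a) \<bullet> v) ^ (k - 2 * j) * ((x - a) \<bullet> (x - a)) ^ j))
      (\<lambda>x. \<Sum>j\<le>?m. A x j + B x j)"
  proof (rule has_laplacian_sum)
    fix j
    show "has_laplacian (\<lambda>x. ?c j * (((x - a) \<bullet> v) ^ (k - 2 * j) * ((x - a) \<bullet> (x - a)) ^ j))
        (\<lambda>x. A x j + B x j)"
      using has_laplacian_cmult[OF has_laplacian_ridge_times_radial[of a v "k - 2 * j" j], of "?c j"]
      by (simp only: A_def B_def distrib_left mult.assoc)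
  qed
  ultimately show ?thesis by (simp add: harmonic_on_UNIV_iff)
qed

text \<open>
  On the sphere the squared distance to the centre is the constant \<open>r\<^sup>2\<close>, so the harmonic zonal
  polynomial with leading term \<open>s\<^sup>k\<close> differs there from \<open>s\<^sup>k\<close> only by multiples of \<open>s\<^bsup>k - 2 j\<^esup>\<close>
  with \<open>j > 0\<close>. Those agree with harmonic functions on the sphere by induction.
\<close>

lemma ridge_power_harmonic_on_sphere:
  fixes a v :: "'a::euclidean_space"
  shows "\<exists>h. harmonic_on h UNIV \<and> (\<forall>x\<in>sphere a r. h x = ((x - a) \<bullet> v) ^ k)"
proof (induction k rule: less_induct)
  case (less k)
  let ?c = "zonal_coeff DIM('a) k (v \<bullet> v)"
  let ?F = "\<lambda>x. \<Sum>j\<le>k div 2. ?c j * (((x - a) \<bullet> v) ^ (k - 2 * j) * ((x - a) \<bullet> (x - a)) ^ j)"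
  have "\<forall>i. \<exists>h. i < k \<longrightarrow> harmonic_on h UNIV \<and> (\<forall>x\<in>sphere a r. h x = ((x - a) \<bullet> v) ^ i)"
    using less.IH by blast
  then obtain h where h: "\<And>i. i < k \<Longrightarrow> harmonic_on (h i) UNIV"
    "\<And>i x. i < k \<Longrightarrow> x \<in> sphere a r \<Longrightarrow> h i x = ((x - a) \<bullet> v) ^ i" by metis
  let ?G = "\<lambda>x. \<Sum>j\<in>{0<..k div 2}. (- ?c j * r ^ (2 * j)) * h (k - 2 * j) x"
  have "harmonic_on ?G UNIV"
    by (rule harmonic_on_UNIV_sum) (auto intro!: h)
  then have "harmonic_on (\<lambda>x. ?F x + ?G x) UNIV"
    by (intro harmonic_on_UNIV_add harmonic_zonal_polynomial)
  moreover have "?F x + ?G x = ((x - a) \<bullet> v) ^ k" if x: "x \<in> sphere a r" for x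
  proof -
    have "(x - a) \<bullet> (x - a) = r\<^sup>2"
      using x by (simp add: dist_norm norm_minus_commute flip: power2_norm_eq_inner)
    then have "?F x = (\<Sum>j\<le>k div 2. ?c j * r ^ (2 * j) * ((x - a) \<bullet> v) ^ (k - 2 * j))"
      by (intro sum.cong) (auto simp: power_mult)
    also have "\<dots> = (\<Sum>j\<in>insert 0 {0<..k div 2}. ?c j * r ^ (2 * j) * ((x - a) \<bullet> v) ^ (k - 2 * j))"
      by (intro sum.cong) auto
    also have "\<dots> = ((x - a) \<bullet> v) ^ k
        + (\<Sum>j\<in>{0<..k div 2}. ?c j * r ^ (2 * j) * ((x - a) \<bullet> v) ^ (k - 2 * j))"
      by simp
    also have "(\<Sum>j\<in>{0<..k div 2}. ?c j * r ^ (2 * j) * ((x - a) \<bullet> v) ^ (k - 2 * j)) = - ?G x"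
      unfolding sum_negf[symmetric] by (intro sum.cong) (auto simp: h(2)[OF _ x])
    finally show ?thesis by simp
  qed
  ultimately show ?case by blast
qed

definition harmonic_approximable :: "'a::euclidean_space set \<Rightarrow> ('a \<Rightarrow> real) \<Rightarrow> bool" where
  "harmonic_approximable K f \<longleftrightarrow>
     (\<forall>e>0. \<exists>h. harmonic_on h UNIV \<and> (\<forall>x\<in>K. \<bar>f x - h x\<bar> < e))"

lemma harmonic_approximable_add:
  assumes "harmonic_approximable K f" "harmonic_approximable K f'"
  shows "harmonic_approximable K (\<lambda>x. f x + f' x)"
  unfolding harmonic_approximable_def
proof (intro allI impI)
  fix e :: real assume "e > 0"
  then have "e / 2 > 0" by simp
  then obtain h h' where h: "harmonic_on h UNIV" "\<forall>x\<in>K. \<bar>f x - h x\<bar> < e / 2"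
    "harmonic_on h' UNIV" "\<forall>x\<in>K. \<bar>f' x - h' x\<bar> < e / 2"
    using assms unfolding harmonic_approximable_def by meson
  have "\<bar>(f x + f' x) - (h x + h' x)\<bar> < e" if "x \<in> K" for x
    using h(2)[rule_format, OF that] h(4)[rule_format, OF that] by linarith
  moreover have "harmonic_on (\<lambda>x. h x + h' x) UNIV"
    using h by (intro harmonic_on_UNIV_add)
  ultimately show "\<exists>h. harmonic_on h UNIV \<and> (\<forall>x\<in>K. \<bar>(f x + f' x) - h x\<bar> < e)" by blast
qed

text \<open>
  The exponential series of \<open>(x - a) \<bullet> v\<close> converges uniformly on the sphere, and each of its terms
  agrees there with a harmonic function.
\<close>

lemma harmonic_approximable_exp:
  fixes a v :: "'a::euclidean_space"
  shows "harmonic_approximable (sphere a r) (\<lambda>x. c * exp (v \<bullet> x))"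
  unfolding harmonic_approximable_def
proof (intro allI impI)
  fix e :: real assume e: "e > 0"
  define d where "d = c * exp (v \<bullet> a)"
  define M where "M = norm v * \<bar>r\<bar>"
  have "uniform_limit (sphere a r) (\<lambda>n x. \<Sum>i<n. ((x - a) \<bullet> v) ^ i /\<^sub>R fact i)
      (\<lambda>x. \<Sum>i. ((x - a) \<bullet> v) ^ i /\<^sub>R fact i) sequentially"
  proof (rule Weierstrass_m_test)
    show "summable (\<lambda>i. M ^ i /\<^sub>R fact i)" by (rule summable_exp_generic)
    fix i x assume "x \<in> sphere a r"
    then have "\<bar>(x - a) \<bullet> v\<bar> \<le> M"
      using Cauchy_Schwarz_ineq2[of "x - a" v]
      by (auto simp: M_def dist_norm norm_minus_commute mult.commute)
    then show "norm (((x - a) \<bullet> v) ^ i /\<^sub>R fact i) \<le> M ^ i /\<^sub>R fact i"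
      by (simp add: power_abs divide_right_mono power_mono abs_mult)
  qed
  then have lim: "uniform_limit (sphere a r) (\<lambda>n x. \<Sum>i<n. ((x - a) \<bullet> v) ^ i /\<^sub>R fact i)
      (\<lambda>x. exp ((x - a) \<bullet> v)) sequentially"
    by (simp add: exp_def)
  have "e / (\<bar>d\<bar> + 1) > 0" using e by simp
  from uniform_limitD[OF lim this] obtain N where
    N: "\<And>x. x \<in> sphere a r \<Longrightarrow>
      dist (\<Sum>i<N. ((x - a) \<bullet> v) ^ i /\<^sub>R fact i) (exp ((x - a) \<bullet> v)) < e / (\<bar>d\<bar> + 1)"
    unfolding eventually_sequentially by blast
  obtain h where h: "\<And>i. harmonic_on (h i) UNIV"
    "\<And>i x. x \<in> sphere a r \<Longrightarrow> h i x = ((x - a) \<bullet> v) ^ i"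
    using ridge_power_harmonic_on_sphere[of a r v] by metis
  let ?h = "\<lambda>x. \<Sum>i<N. (d / fact i) * h i x"
  have "harmonic_on ?h UNIV" by (rule harmonic_on_UNIV_sum) (rule h)
  moreover have "\<bar>c * exp (v \<bullet> x) - ?h x\<bar> < e" if x: "x \<in> sphere a r" for x
  proof -
    let ?S = "\<Sum>i<N. ((x - a) \<bullet> v) ^ i /\<^sub>R fact i"
    have "?h x = d * ?S"
      unfolding sum_distrib_left by (intro sum.cong) (auto simp: h(2)[OF x] field_simps)
    moreover have "c * exp (v \<bullet> x) = d * exp ((x - a) \<bullet> v)"
      by (simp add: d_def inner_diff_left inner_commute[of v] mult.assoc flip: exp_add)
    ultimately have "\<bar>c * exp (v \<bullet> x) - ?h x\<bar> = \<bar>d\<bar> * \<bar>?S - exp ((x - a) \<bullet> v)\<bar>"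
      by (simp add: abs_minus_commute flip: right_diff_distrib abs_mult)
    also have "\<dots> \<le> \<bar>d\<bar> * (e / (\<bar>d\<bar> + 1))"
      using N[OF x] by (intro mult_left_mono) (auto simp: dist_real_def)
    also have "\<dots> < e" using e by (simp add: field_simps)
    finally show ?thesis .
  qed
  ultimately show "\<exists>h. harmonic_on h UNIV \<and> (\<forall>x\<in>sphere a r. \<bar>c * exp (v \<bullet> x) - h x\<bar> < e)" by blast
qed

text \<open>
  Products of harmonic functions need not be harmonic, but the linear span of the exponentials
  \<open>x \<mapsto> exp (v \<bullet> x)\<close> is an algebra, to which the Stone-Weierstrass theorem applies.
\<close>

inductive exponential_sum :: "('a::euclidean_space \<Rightarrow> real) \<Rightarrow> bool" where
  exponential: "exponential_sum (\<lambda>x. c * exp (v \<bullet> x))"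
| add: "exponential_sum f \<Longrightarrow> exponential_sum g \<Longrightarrow> exponential_sum (\<lambda>x. f x + g x)"

lemma exponential_sum_mult:
  assumes "exponential_sum f" "exponential_sum g"
  shows "exponential_sum (\<lambda>x. f x * g x)"
  using assms(1)
proof (induction rule: exponential_sum.induct)
  case (exponential c v)
  show ?case using assms(2)
  proof (induction rule: exponential_sum.induct)
    case (exponential c' v')
    have "(\<lambda>x. c * exp (v \<bullet> x) * (c' * exp (v' \<bullet> x))) = (\<lambda>x. (c * c') * exp ((v + v') \<bullet> x))"
      by (simp add: inner_add_left exp_add fun_eq_iff)
    then show ?case using exponential_sum.exponential by metis
  next
    case (add f g)
    then show ?case using exponential_sum.add by (fastforce simp: distrib_left)
  qed
next
  case (add f g)
  then show ?case using exponential_sum.add by (fastforce simp: distrib_right)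
qed

text \<open>
  This replaces the solution of the Dirichlet problem on a ball: up to an arbitrarily small error,
  continuous boundary values have a harmonic extension, which even is harmonic on the whole space.
\<close>

theorem harmonic_approximable_sphere:
  fixes f :: "'a::euclidean_space \<Rightarrow> real"
  assumes "continuous_on (sphere a r) f"
  shows "harmonic_approximable (sphere a r) f"
  unfolding harmonic_approximable_def
proof (intro allI impI)
  fix e :: real assume "e > 0"
  then have e: "e / 2 > 0" by simp
  have "\<exists>g. exponential_sum g \<and> (\<forall>x\<in>sphere a r. \<bar>f x - g x\<bar> < e / 2)"
  proof (rule Stone_Weierstrass_HOL)
    show "exponential_sum (\<lambda>x::'a. c)" for c
      using exponential[of c 0] by simp
    show "continuous_on (sphere a r) g" if "exponential_sum g" for g
      using that by induction (auto intro!: continuous_intros)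
    show "\<exists>g. exponential_sum g \<and> g x \<noteq> g y"
      if "x \<in> sphere a r \<and> y \<in> sphere a r \<and> x \<noteq> y" for x y
    proof -
      \<comment> \<open>The exponential in the direction \<open>x - y\<close> separates \<open>x\<close> from \<open>y\<close>.\<close>
      have "(x - y) \<bullet> (x - y) \<noteq> 0" using that by simp
      then have "1 * exp ((x - y) \<bullet> x) \<noteq> 1 * exp ((x - y) \<bullet> y)"
        by (simp add: inner_diff_right)
      with exponential[of 1 "x - y"] show ?thesis by blast
    qed
  qed (use assms e in \<open>auto intro: exponential_sum.add exponential_sum_mult\<close>)
  then obtain g where g: "exponential_sum g" "\<forall>x\<in>sphere a r. \<bar>f x - g x\<bar> < e / 2" by blast
  have "harmonic_approximable (sphere a r) g"
    using g(1) by induction (auto intro: harmonic_approximable_exp harmonic_approximable_add)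
  then obtain h where h: "harmonic_on h UNIV" "\<forall>x\<in>sphere a r. \<bar>g x - h x\<bar> < e / 2"
    using e unfolding harmonic_approximable_def by meson
  have "\<bar>f x - h x\<bar> < e" if "x \<in> sphere a r" for x
    using g(2)[rule_format, OF that] h(2)[rule_format, OF that] by linarith
  then show "\<exists>h. harmonic_on h UNIV \<and> (\<forall>x\<in>sphere a r. \<bar>f x - h x\<bar> < e)" using h(1) by blast
qed

section \<open>Monotonicity of ball means and the maximum principle\<close>

lemma set_integral_ball_diff_const:
  fixes w :: "'a::euclidean_space \<Rightarrow> real"
  assumes "continuous_on (cball p r) w" "r \<ge> 0"
  shows "(LINT x:ball p r|lborel. w x - c)
    = (LINT x:ball p r|lborel. w x) - c * (unit_ball_vol (real DIM('a)) * r ^ DIM('a))"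
proof -
  have "set_integrable lborel (ball p r) w" "set_integrable lborel (ball p r) (\<lambda>_. c)"
    by (rule set_integrable_continuous_cball[of p r]; use assms in auto)+
  from set_integral_diff(2)[OF this] show ?thesis
    using emeasure_lborel_ball_finite[of p r] assms
    by (simp add: set_integral_const measure_ball_lborel)
qed

text \<open>
  By the quotient rule and the formula for the derivative of the ball integral \<open>F\<close>, the quotient
  \<open>A s = F s / s\<^sup>n\<close> has a derivative of the same sign as \<open>s\<^sup>n G s - F s\<close>, where \<open>G\<close> is the radial integral.
  So the hypothesis says that ball means increase with the radius, and as the radius tends to zero
  they tend to the value at the centre.
\<close>

lemma value_le_ball_mean:
  fixes w :: "'a::euclidean_space \<Rightarrow> real"
  assumes w: "continuous_on (cball p R) w"
    and mean: "\<And>r. 0 < r \<Longrightarrow> r < R \<Longrightarrow>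
      (LINT x:ball p r|lborel. w x) \<le> r ^ DIM('a) * radial_integral w p r"
    and r: "0 < r" "r < R"
  shows "w p * (unit_ball_vol (real DIM('a)) * r ^ DIM('a)) \<le> (LINT x:ball p r|lborel. w x)"
proof -
  let ?n = "DIM('a)" and ?V = "unit_ball_vol (real DIM('a))"
  let ?F = "\<lambda>s. LINT x:ball p s|lborel. w x"
  define A where "A = (\<lambda>s. ?F s / s ^ ?n)"
  have cont: "continuous_on (cball p s) w" if "s \<le> R" for s
    using w subset_cball[OF that] by (rule continuous_on_subset)
  have A': "(A has_real_derivative
      (real ?n * s ^ (?n - 1) * radial_integral w p s * s ^ ?n - ?F s * (real ?n * s ^ (?n - 1)))
        / (s ^ ?n * s ^ ?n)) (at s)" if "0 < s" "s < R" for s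
    unfolding A_def
    by (rule DERIV_divide has_real_derivative_ball_integral[OF that w])+
      (use that in \<open>auto intro!: derivative_eq_intros\<close>)
  have mono: "A s \<le> A r" if s: "0 < s" "s \<le> r" for s
  proof (rule DERIV_nonneg_imp_nondecreasing[OF s(2)])
    fix t assume t: "s \<le> t" "t \<le> r"
    then have t': "0 < t" "t < R" using s r by auto
    have "0 \<le> real ?n * t ^ (?n - 1) * (t ^ ?n * radial_integral w p t - ?F t)"
      using mean[OF t'] t' by simp
    then have "0 \<le> (real ?n * t ^ (?n - 1) * radial_integral w p t * t ^ ?n - ?F t * (real ?n * t ^ (?n - 1)))
        / (t ^ ?n * t ^ ?n)"
      using t' by (intro divide_nonneg_nonneg) (auto simp: algebra_simps)
    then show "\<exists>y. (A has_real_derivative y) (at t) \<and> 0 \<le> y" using A'[OF t'] by blast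
  qed
  have V: "?V > 0" by simp
  have approx: "w p * ?V \<le> A r + e * ?V" if e: "e > 0" for e
  proof -
    have "p \<in> cball p R" using r by simp
    then obtain d where d: "d > 0" "\<And>x. x \<in> cball p R \<Longrightarrow> dist x p < d \<Longrightarrow> dist (w x) (w p) < e"
      using w e unfolding continuous_on_iff by metis
    define s where "s = min r d"
    have s: "0 < s" "s \<le> r" "s \<le> d" using r d by (auto simp: s_def)
    have "0 \<le> (LINT x:ball p s|lborel. w x - (w p - e))"
      unfolding set_lebesgue_integral_def
    proof (rule integral_nonneg_AE, intro AE_I2)
      fix x
      show "0 \<le> indicator (ball p s) x *\<^sub>R (w x - (w p - e))"
      proof (cases "x \<in> ball p s")
        case True
        then have "dist (w x) (w p) < e" using s r by (intro d) (auto simp: dist_commute)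
        then show ?thesis by (simp add: dist_real_def)
      qed simp
    qed
    then have "(w p - e) * (?V * s ^ ?n) \<le> ?F s"
      using set_integral_ball_diff_const[OF cont, of s "w p - e"] s r by simp
    then have "(w p - e) * ?V \<le> A s" using s by (simp add: A_def field_simps)
    with mono[OF s(1,2)] show ?thesis by (simp add: algebra_simps)
  qed
  have "w p * ?V \<le> A r"
  proof (rule field_le_epsilon)
    fix e :: real assume "e > 0"
    then show "w p * ?V \<le> A r + e" using approx[of "e / ?V"] V by simp
  qed
  then show ?thesis using r by (simp add: A_def field_simps)
qed

lemma continuous_integral_nonpos_imp_zero:
  fixes f :: "'a::euclidean_space \<Rightarrow> real"
  assumes f: "continuous_on (cball p r) f" and nonneg: "\<And>x. x \<in> ball p r \<Longrightarrow> f x \<ge> 0"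
    and int: "(LINT x:ball p r|lborel. f x) \<le> 0" and q: "q \<in> ball p r"
  shows "f q = 0"
proof (rule ccontr)
  assume "f q \<noteq> 0"
  then have fq: "f q > 0" using nonneg[OF q] by simp
  have "q \<in> cball p r" "f q / 2 > 0" using q fq by auto
  then obtain d' where d': "d' > 0"
    "\<And>x. x \<in> cball p r \<Longrightarrow> dist x q < d' \<Longrightarrow> dist (f x) (f q) < f q / 2"
    using f unfolding continuous_on_iff by blast
  define d where "d = min d' (r - dist p q)"
  have d0: "d > 0" using d' q by (simp add: d_def)
  have d: "f x > f q / 2 \<and> x \<in> ball p r" if "dist x q < d" for x
  proof -
    have "x \<in> ball p r"
      using that dist_triangle[of p x q] by (simp add: d_def dist_commute)
    moreover have "\<bar>f x - f q\<bar> < f q / 2"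
      using d'(2)[of x] that calculation by (auto simp: d_def dist_real_def)
    then have "f x > f q / 2" by linarith
    ultimately show ?thesis by simp
  qed
  have sub: "ball q d \<subseteq> ball p r" using d by (auto simp: dist_commute)
  have "0 < f q / 2 * measure lborel (ball q d)"
    using fq d0 by (simp add: measure_ball_lborel)
  also have "\<dots> = (LINT x:ball q d|lborel. f q / 2)"
    using emeasure_lborel_ball_finite[of q d] by (simp add: set_integral_const)
  also have "\<dots> \<le> (LINT x:ball p r|lborel. f x)"
    unfolding set_lebesgue_integral_def
  proof (rule integral_mono)
    show "integrable lborel (\<lambda>x. indicator (ball p r) x *\<^sub>R f x)"
      using set_integrable_continuous_cball[OF f ball_subset_cball] by (simp add: set_integrable_def)
    show "integrable lborel (\<lambda>x. indicator (ball q d) x *\<^sub>R (f q / 2))"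
      using set_integrable_continuous_cball[of q d "\<lambda>_. f q / 2" "ball q d"]
      by (auto simp: set_integrable_def)
    show "indicator (ball q d) x *\<^sub>R (f q / 2) \<le> indicator (ball p r) x *\<^sub>R f x" for x
      using d[of x] sub nonneg[of x] by (auto simp: indicator_def dist_commute intro: less_imp_le)
  qed
  finally show False using int by simp
qed

text \<open>
  If the maximum of \<open>w\<close> were positive, it would be attained only inside the ball. At a maximum point
  the mean inequality forces \<open>w\<close> to be constant on a surrounding ball, which contains maximum points
  farther from \<open>a\<close>. A maximum point at the greatest distance from \<open>a\<close> gives a contradiction.
\<close>

lemma maximum_principle_ball_mean:
  fixes w :: "'a::euclidean_space \<Rightarrow> real"
  assumes r: "r > 0" and w: "continuous_on (cball a r) w"
    and mean: "\<And>p s. s > 0 \<Longrightarrow> cball p s \<subseteq> ball a r \<Longrightarrow>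
      w p * (unit_ball_vol (real DIM('a)) * s ^ DIM('a)) \<le> (LINT x:ball p s|lborel. w x)"
    and bd: "\<And>x. x \<in> sphere a r \<Longrightarrow> w x \<le> 0" and x: "x \<in> cball a r"
  shows "w x \<le> 0"
proof (rule ccontr)
  assume "\<not> w x \<le> 0"
  obtain m where m: "m \<in> cball a r" "\<And>y. y \<in> cball a r \<Longrightarrow> w y \<le> w m"
    using continuous_attains_sup[OF compact_cball _ w] x by blast
  have pos: "w m > 0" using m(2)[OF x] \<open>\<not> w x \<le> 0\<close> by simp
  define K where "K = {y \<in> cball a r. w y = w m}"
  have "closed K"
    unfolding K_def using w by (rule continuous_closed_preimage_constant) simp
  then have "compact K"
    using compact_Int_closed[of "cball a r" K] by (simp add: K_def Int_absorb1 Collect_mono_iff inf.absorb2 subset_iff)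
  moreover have "K \<noteq> {}" using m by (auto simp: K_def)
  moreover have "continuous_on K (dist a)" by (intro continuous_intros)
  ultimately obtain p where p: "p \<in> K" "\<And>y. y \<in> K \<Longrightarrow> dist a y \<le> dist a p"
    using continuous_attains_sup[of K "dist a"] by blast
  have pball: "p \<in> ball a r" using p(1) bd[of p] pos by (force simp: K_def)
  define s where "s = (r - dist a p) / 2"
  have s: "s > 0" using pball by (simp add: s_def)
  have sub: "cball p s \<subseteq> ball a r"
  proof
    fix y assume "y \<in> cball p s"
    then show "y \<in> ball a r" using dist_triangle[of a y p] s by (auto simp: s_def)
  qed
  have sub': "cball p s \<subseteq> cball a r" using sub ball_subset_cball by blast
  have cont: "continuous_on (cball p s) w" using w sub' by (rule continuous_on_subset)
  have wp: "w p = w m" using p(1) by (simp add: K_def)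
  have eq: "w y = w m" if "y \<in> ball p s" for y
  proof -
    have "w m - w y = 0"
    proof (rule continuous_integral_nonpos_imp_zero[OF _ _ _ that])
      show "continuous_on (cball p s) (\<lambda>y. w m - w y)" by (intro continuous_intros cont)
      show "0 \<le> w m - w y" if "y \<in> ball p s" for y
        using m(2)[of y] that sub' by force
      have "(LINT y:ball p s|lborel. w m - w y) = - (LINT y:ball p s|lborel. w y - w m)"
        by (simp add: set_lebesgue_integral_def algebra_simps flip: Bochner_Integration.integral_minus)
      then show "(LINT y:ball p s|lborel. w m - w y) \<le> 0"
        using mean[OF s sub] set_integral_ball_diff_const[OF cont, of "w m"] s by (simp add: wp)
    qed
    then show ?thesis by simp
  qed
  \<comment> \<open>The outward direction at \<open>p\<close>; every direction is outward if \<open>p\<close> is the centre.\<close>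
  obtain u :: 'a where u: "norm u = 1" "dist a (p + (s / 2) *\<^sub>R u) > dist a p"
  proof (cases "p = a")
    case True
    obtain b :: 'a where "b \<in> Basis" using nonempty_Basis by blast
    then show ?thesis using True s by (intro that[of b]) (auto simp: dist_norm)
  next
    case False
    have "p + (s / 2) *\<^sub>R sgn (p - a) - a = (norm (p - a) + s / 2) *\<^sub>R sgn (p - a)"
      using False by (simp add: sgn_div_norm algebra_simps)
    then have "dist (p + (s / 2) *\<^sub>R sgn (p - a)) a = dist p a + s / 2"
      using False s by (simp add: dist_norm norm_sgn)
    then show ?thesis using False s by (intro that[of "sgn (p - a)"]) (auto simp: norm_sgn dist_commute)
  qed
  let ?q = "p + (s / 2) *\<^sub>R u"
  have q: "?q \<in> ball p s" using u s by (simp add: dist_norm)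
  then have "w ?q = w m" "?q \<in> cball a r"
    using eq sub' ball_subset_cball by blast+
  then have "?q \<in> K" by (simp add: K_def)
  then show False using p(2) u by fastforce
qed

section \<open>Subharmonicity and the comparison of means\<close>

theorem subharmonic_on_iff_ball_integral_le_radial_integral:
  fixes u :: "'a::euclidean_space \<Rightarrow> real"
  assumes u: "continuous_on \<Omega> u"
  shows "subharmonic_on u \<Omega> \<longleftrightarrow>
    (\<forall>a r. r > 0 \<longrightarrow> cball a r \<subseteq> \<Omega> \<longrightarrow>
       (LINT x:ball a r|lborel. u x) \<le> r ^ DIM('a) * radial_integral u a r)"
proof (intro iffI allI impI)
  fix a r
  assume sub: "subharmonic_on u \<Omega>" and r: "r > 0" and ball: "cball a r \<subseteq> \<Omega>"
  let ?n = "DIM('a)" and ?V = "unit_ball_vol (real DIM('a))"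
  define c where "c = 2 * r ^ ?n * ?V"
  have uc: "continuous_on (cball a r) u" using u ball by (rule continuous_on_subset)
  have c: "c > 0" using r by (simp add: c_def)
  have est: "(LINT x:ball a r|lborel. u x) \<le> r ^ ?n * radial_integral u a r + e * c" if e: "e > 0" for e
  proof -
    \<comment> \<open>Approximating \<open>u + e\<close> up to \<open>e\<close> yields boundary values between \<open>u\<close> and \<open>u + 2 e\<close>,
      so that \<open>h\<close> is an admissible majorant of \<open>u\<close>.\<close>
    have "continuous_on (sphere a r) (\<lambda>x. u x + e)"
      by (intro continuous_intros continuous_on_subset[OF uc]) auto
    from harmonic_approximable_sphere[OF this] e obtain h where h: "harmonic_on h UNIV"
      and happ: "\<And>x. x \<in> sphere a r \<Longrightarrow> \<bar>u x + e - h x\<bar> < e"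
      unfolding harmonic_approximable_def by blast
    have above: "u x \<le> h x" and below: "h x \<le> u x + 2 * e" if "x \<in> sphere a r" for x
      using happ[OF that] by linarith+
    have hc: "continuous_on (cball a r) h"
      using harmonic_on_continuous_on[OF h] by (rule continuous_on_subset) simp
    have "harmonic_on h (ball a r)" using h unfolding harmonic_on_def
      by (meson UNIV_I continuous_on_subset top_greatest)
    then have uh: "u x \<le> h x" if "x \<in> ball a r" for x
      using sub r ball hc above that unfolding subharmonic_on_def by blast
    have "(LINT x:ball a r|lborel. u x) \<le> (LINT x:ball a r|lborel. h x)"
      by (rule set_integral_mono)
        (use set_integrable_continuous_cball[OF uc ball_subset_cball]
          set_integrable_continuous_cball[OF hc ball_subset_cball] uh in auto)
    also have "\<dots> = r ^ ?n * radial_integral h a r"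
      by (rule harmonic_ball_eq_sphere[OF h r, of "r + 1"]) auto
    also have "\<dots> \<le> r ^ ?n * (radial_integral u a r + 2 * e * ?V)"
      using r by (intro mult_left_mono radial_integral_le hc uc below) auto
    finally show ?thesis by (simp add: c_def algebra_simps)
  qed
  show "(LINT x:ball a r|lborel. u x) \<le> r ^ ?n * radial_integral u a r"
  proof (rule field_le_epsilon)
    fix e :: real assume "e > 0"
    then show "(LINT x:ball a r|lborel. u x) \<le> r ^ ?n * radial_integral u a r + e"
      using est[of "e / c"] c by simp
  qed
next
  assume ineq: "\<forall>a r. r > 0 \<longrightarrow> cball a r \<subseteq> \<Omega> \<longrightarrow>
       (LINT x:ball a r|lborel. u x) \<le> r ^ DIM('a) * radial_integral u a r"
  show "subharmonic_on u \<Omega>"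
    unfolding subharmonic_on_def
  proof (intro conjI allI impI ballI u)
    fix a r h x
    assume r: "r > 0" and ball: "cball a r \<subseteq> \<Omega>" and h: "harmonic_on h (ball a r)"
      and hc: "continuous_on (cball a r) h" and bd: "\<forall>x\<in>sphere a r. u x \<le> h x"
      and x: "x \<in> ball a r"
    have uc: "continuous_on (cball a r) u" using u ball by (rule continuous_on_subset)
    have "u x - h x \<le> 0"
    proof (rule maximum_principle_ball_mean[where w = "\<lambda>x. u x - h x", OF r])
      show wc: "continuous_on (cball a r) (\<lambda>x. u x - h x)" by (intro continuous_intros uc hc)
      show "u y - h y \<le> 0" if "y \<in> sphere a r" for y using bd that by auto
      show "x \<in> cball a r" using x by simp
      fix p s assume s: "s > 0" and ps: "cball p s \<subseteq> ball a r"
      \<comment> \<open>A slightly larger concentric ball, as the mean inequalities are used at radii below \<open>R\<close>.\<close>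
      define R where "R = (s + (r - dist p a)) / 2"
      have "dist p a + s < r" using ps s by (simp add: cball_subset_ball_iff)
      then have R: "s < R" "cball p R \<subseteq> ball a r"
        by (auto simp: R_def cball_subset_ball_iff field_simps)
      have sub: "cball p t \<subseteq> cball a r" if "t \<le> R" for t
        using subset_cball[OF that, of p] R(2) ball_subset_cball[of a r] by blast
      show "(u p - h p) * (unit_ball_vol (real DIM('a)) * s ^ DIM('a))
          \<le> (LINT x:ball p s|lborel. u x - h x)"
      proof (rule value_le_ball_mean[of p R "\<lambda>x. u x - h x"])
        show "continuous_on (cball p R) (\<lambda>x. u x - h x)"
          using wc sub[OF order_refl] by (rule continuous_on_subset)
        fix t assume t: "0 < t" "t < R"
        then have t': "cball p t \<subseteq> cball a r" by (intro sub) simp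
        have ct: "continuous_on (cball p t) u" "continuous_on (cball p t) h"
          using uc hc t' by (blast intro: continuous_on_subset)+
        have "(LINT x:ball p t|lborel. u x - h x)
            = (LINT x:ball p t|lborel. u x) - (LINT x:ball p t|lborel. h x)"
          by (rule set_integral_diff(2); rule set_integrable_continuous_cball[of p t]; use ct in auto)
        also have "\<dots> \<le> t ^ DIM('a) * radial_integral u p t - t ^ DIM('a) * radial_integral h p t"
          using ineq t t' ball harmonic_ball_eq_sphere[OF h t R(2)] by (auto intro!: diff_mono)
        also have "\<dots> = t ^ DIM('a) * radial_integral (\<lambda>x. u x - h x) p t"
          using radial_integral_diff[OF less_imp_le[OF t(1)] ct] by (simp add: right_diff_distrib)
        finally show "(LINT x:ball p t|lborel. u x - h x)
            \<le> t ^ DIM('a) * radial_integral (\<lambda>x. u x - h x) p t" .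
      qed (use s R in auto)
    qed
    then show "u x \<le> h x" by simp
  qed
qed

theorem theorem1p3:
  fixes \<Omega> :: "(real ^ 'n) set" and u :: "real ^ 'n \<Rightarrow> real"
  assumes "open \<Omega>" and "connected \<Omega>" and "\<Omega> \<noteq> {}"
    and "continuous_on \<Omega> u"
  shows "subharmonic_on u \<Omega> \<longleftrightarrow>
    (\<forall>a r. r > 0 \<longrightarrow> cball a r \<subseteq> \<Omega> \<longrightarrow>
       1 / measure lborel (ball a r) * (LINT x:ball a r|lborel. u x)
         \<le> 1 / measure (surface_measure a r) (sphere a r)
             * (LINT x:sphere a r|surface_measure a r. u x))"
proof -
  have "(1 / measure lborel (ball a r) * (LINT x:ball a r|lborel. u x)
         \<le> 1 / measure (surface_measure a r) (sphere a r)
             * (LINT x:sphere a r|surface_measure a r. u x))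
      \<longleftrightarrow> (LINT x:ball a r|lborel. u x) \<le> r ^ DIM(real ^ 'n) * radial_integral u a r"
    if "r > 0" "cball a r \<subseteq> \<Omega>" for a r
    using that(1) continuous_on_subset[OF assms(4) that(2)] by (rule ball_mean_le_sphere_mean_iff)
  then show ?thesis
    unfolding subharmonic_on_iff_ball_integral_le_radial_integral[OF assms(4)] by (intro iff_allI imp_cong refl) simp
qed

end
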